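(* Suppose that $M$ is RDDZ, $b,t\ge 0$ entrywise, we can sample from the distribution $t/\|t\|_1$ in $O(1)$ time, and $\|t\|_1$ is known. Then there exists a randomized algorithm that computes $\hat x$ such that $\Pr\{|\hat x-t^{\top}x^{\ast}|\le\varepsilon\|x^{\ast}\|_\infty\}\ge\frac34$ in time $O(f_{\mathrm{row}}(M)\|t\|_1^2L^2\varepsilon^{-2})$, i.e. $\widetilde O(f_{\mathrm{row}}(M)\|t\|_1^2\gamma^{-2}\varepsilon^{-2})$.
   Context: Setting: $M\in\mathbb{R}^{n\times n}$, $b\in\operatorname{range}(M)$, $t\in\mathbb{R}^n$, $b,t\ne0$, nonzero entries of absolute value in $[1/\mathrm{poly}(n),\mathrm{poly}(n)]$. $M$ is RDDZ if its diagonal is positive, $M(j,j)\ge\sum_{k\ne j}|M(j,k)|$ for all $j$, and all off-diagonal entries are $\le0$. Write $M=D_M-A_M^{\top}$ with $D_M$ the diagonal part and $A_M^{\top}$ with zero diagonal; $x^{\ast}:=\frac12\sum_{\ell\ge0}(\frac12(I+D_M^{-1}A_M^{\top}))^{\ell}D_M^{-1}b$ (a solution of $Mx=b$). Access: diagonal entries of $M$ in $O(1)$; nonzero entries of any row/column of $M$ in time linear in their number; entries of $b,t$ in $O(1)$. The algorithm is given $\varepsilon>0$ and $\gamma$ with $0<\gamma\le\gamma_{\max}(M)$, where $\gamma_{\max}(M)=\max_{p\in[1,\infty]}\big(1-\|\frac12(I+D_M^{-1/q}A_M^{\top}D_M^{-1/p})|_{\operatorname{range}(I-D_M^{-1/q}A_M^{\top}D_M^{-1/p})}\|_p\big)$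 ($q$ Hölder conjugate of $p$). $L=\Theta\big(\frac1\gamma\log(\frac{1}{\gamma E}d_{\max}(M)\|t\|_0\|D_M^{-1}t\|_\infty\|b\|_0\|D_M^{-1}b\|_\infty)\big)$ where $E$ is the target accuracy and suitable bounds on quantities inside the log are known. $f_{\mathrm{row}}(M)$ is the maximum time to simulate one step of the (possibly terminating) random walk with transition matrix $\frac12(I+D_M^{-1}|A_M^{\top}|)$. *)

theory Defs
  imports "HOL-Probability.SPMF" "Jordan_Normal_Form.Matrix"
begin

unbundle no vec_syntax
no_notation inner (infix "\<bullet>" 70)
hide_const (open) Finite_Cartesian_Product.vec Finite_Cartesian_Product.mat
  Finite_Cartesian_Product.row Finite_Cartesian_Product.column
hide_type (open) Finite_Cartesian_Product.vec

definition p_norm :: "ereal \<Rightarrow> real vec \<Rightarrow> real" where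
  "p_norm p v =
     (if p = \<infinity> then (MAX i\<in>{..<dim_vec v}. \<bar>v $ i\<bar>)
      else (\<Sum>i<dim_vec v. \<bar>v $ i\<bar> powr real_of_ereal p) powr (1 / real_of_ereal p))"

definition norm0 :: "real vec \<Rightarrow> nat" where
  "norm0 v = card {i. i < dim_vec v \<and> v $ i \<noteq> 0}"

definition mat_range :: "real mat \<Rightarrow> real vec set" where
  "mat_range A = (\<lambda>x. A *\<^sub>v x) ` carrier_vec (dim_col A)"

text \<open>The operator norm of \<open>A\<close> restricted to the subspace \<open>S\<close>; inserting \<open>0\<close> only matters
  for \<open>S = {0}\<close>.\<close>

definition restricted_norm :: "ereal \<Rightarrow> real mat \<Rightarrow> real vec set \<Rightarrow> real" where
  "restricted_norm p A S =
     Sup (insert 0 {p_norm p (A *\<^sub>v v) / p_norm p v | v. v \<in> S \<and> v \<noteq> 0\<^sub>v (dim_vec v)})"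

definition diag_part :: "real mat \<Rightarrow> real mat" where
  "diag_part M = mat (dim_row M) (dim_row M) (\<lambda>(i, j). if i = j then M $$ (i, i) else 0)"

definition diag_powr :: "real mat \<Rightarrow> real \<Rightarrow> real mat" where
  "diag_powr M s = mat (dim_row M) (dim_row M) (\<lambda>(i, j). if i = j then M $$ (i, i) powr s else 0)"

abbreviation diag_inv :: "real mat \<Rightarrow> real mat" where
  "diag_inv M \<equiv> diag_powr M (- 1)"

text \<open>\<open>AT M\<close> is the matrix \<open>A\<^sub>M\<^sup>T\<close> of the splitting \<open>M = D\<^sub>M - A\<^sub>M\<^sup>T\<close>; no transposition takes place.\<close>

definition AT :: "real mat \<Rightarrow> real mat" where
  "AT M = diag_part M - M"

definition RDDZ :: "real mat \<Rightarrow> bool" where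
  "RDDZ M \<longleftrightarrow> square_mat M \<and>
     (\<forall>j<dim_row M. M $$ (j, j) > 0) \<and>
     (\<forall>j<dim_row M. M $$ (j, j) \<ge> (\<Sum>k\<in>{..<dim_row M} - {j}. \<bar>M $$ (j, k)\<bar>)) \<and>
     (\<forall>j<dim_row M. \<forall>k<dim_row M. j \<noteq> k \<longrightarrow> M $$ (j, k) \<le> 0)"

definition d_max :: "real mat \<Rightarrow> real" where
  "d_max M = (MAX j\<in>{..<dim_row M}. M $$ (j, j))"

definition x_star :: "real mat \<Rightarrow> real vec \<Rightarrow> real vec" where
  "x_star M b =
     (let n = dim_row M; W = (1/2) \<cdot>\<^sub>m (1\<^sub>m n + diag_inv M * AT M)
      in Matrix.vec n (\<lambda>i. 1/2 * (\<Sum>l. ((W ^\<^sub>m l) *\<^sub>v (diag_inv M *\<^sub>v b)) $ i)))"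

definition scaled_AT :: "real mat \<Rightarrow> ereal \<Rightarrow> ereal \<Rightarrow> real mat" where
  "scaled_AT M p q =
     diag_powr M (- real_of_ereal (1 / q)) * AT M * diag_powr M (- real_of_ereal (1 / p))"

text \<open>The supremum is a maximum, since the restricted norm is continuous in \<open>p \<in> [1, \<infinity>]\<close>.\<close>

definition gamma_max :: "real mat \<Rightarrow> real" where
  "gamma_max M =
     Sup {1 - restricted_norm p ((1/2) \<cdot>\<^sub>m (1\<^sub>m (dim_row M) + scaled_AT M p q))
                (mat_range (1\<^sub>m (dim_row M) - scaled_AT M p q))
          | p q. 1 \<le> p \<and> 1 \<le> q \<and> 1 / p + 1 / q = (1 :: ereal)}"

text \<open>The argument of the logarithm in \<open>L\<close>, for target accuracy \<open>E\<close>.\<close>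

definition log_arg :: "real mat \<Rightarrow> real vec \<Rightarrow> real vec \<Rightarrow> real \<Rightarrow> real \<Rightarrow> real" where
  "log_arg M b t \<gamma> E =
     1 / (\<gamma> * E) * d_max M * real (norm0 t) * p_norm \<infinity> (diag_inv M *\<^sub>v t)
       * real (norm0 b) * p_norm \<infinity> (diag_inv M *\<^sub>v b)"

definition poly_bounded :: "real poly \<Rightarrow> nat \<Rightarrow> real \<Rightarrow> bool" where
  "poly_bounded pl n x \<longleftrightarrow> x \<noteq> 0 \<longrightarrow> 1 / poly pl (real n) \<le> \<bar>x\<bar> \<and> \<bar>x\<bar> \<le> poly pl (real n)"

definition setting :: "real poly \<Rightarrow> nat \<Rightarrow> real mat \<Rightarrow> real vec \<Rightarrow> real vec \<Rightarrow> bool" where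
  "setting pl n M b t \<longleftrightarrow>
     M \<in> carrier_mat n n \<and> b \<in> mat_range M \<and> t \<in> carrier_vec n \<and> b \<noteq> 0\<^sub>v n \<and> t \<noteq> 0\<^sub>v n \<and>
     (\<forall>i<n. \<forall>j<n. poly_bounded pl n (M $$ (i, j))) \<and>
     (\<forall>i<n. poly_bounded pl n (b $ i)) \<and> (\<forall>i<n. poly_bounded pl n (t $ i))"

definition walk_mat :: "real mat \<Rightarrow> real mat" where
  "walk_mat M = (1/2) \<cdot>\<^sub>m (1\<^sub>m (dim_row M) + diag_inv M * map_mat abs (AT M))"

text \<open>One step of the walk from \<open>j < n\<close>. The value \<open>n\<close>, which is not an index, signals termination,
  and has the probability missing from row \<open>j\<close>.\<close>

definition walk_step :: "real mat \<Rightarrow> nat \<Rightarrow> nat pmf" where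
  "walk_step M j =
     (let n = dim_row M in
      if j < n then
        embed_pmf (\<lambda>k. if k < n then walk_mat M $$ (j, k)
                        else if k = n then 1 - (\<Sum>k<n. walk_mat M $$ (j, k)) else 0)
      else return_pmf n)"

definition vec_sample :: "real vec \<Rightarrow> nat pmf" where
  "vec_sample t = embed_pmf (\<lambda>i. if i < dim_vec t then t $ i / p_norm 1 t else 0)"

text \<open>\<open>step_time j\<close> is the time to simulate one step of the walk from \<open>j\<close>.\<close>

record lin_sys =
  mtx :: "real mat"
  rhs :: "real vec"
  tgt :: "real vec"
  step_time :: "nat \<Rightarrow> nat"

definition f_row :: "lin_sys \<Rightarrow> nat" where
  "f_row S = (MAX j\<in>{..<dim_row (mtx S)}. step_time S j)"

text \<open>The machine has a memory of natural numbers, a memory of reals, and a clock. In the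
  instructions below all operands are addresses, except for the number in \<open>NConst\<close>; the first
  operand is the destination. There is no rounding from reals to integers, and there are no real
  constants: a program can only contain a finite amount of information.\<close>

record state =
  nmem :: "nat \<Rightarrow> nat"
  rmem :: "nat \<Rightarrow> real"
  clock :: nat

datatype instr =
    NConst nat nat
  | NAdd nat nat nat
  | NSub nat nat nat
  | NLoad nat nat
  | NStore nat nat
  | RofN nat nat
  | RAdd nat nat nat
  | RSub nat nat nat
  | RMul nat nat nat
  | RDiv nat nat nat
  | RLoad nat nat
  | RStore nat nat
  | Flip nat
  | ReadDiag nat nat
  | ReadRow nat nat
  | ReadCol nat nat
  | ReadB nat nat
  | ReadT nat nat
  | SampleT nat
  | WalkStep nat nat

datatype test = NLess nat nat | NEq nat nat | RLess nat nat

datatype prog =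
    Do instr
  | Seq prog prog
  | If test prog prog
  | While test prog

definition nset :: "nat \<Rightarrow> nat \<Rightarrow> state \<Rightarrow> state" where
  "nset a k s = s\<lparr>nmem := (nmem s)(a := k)\<rparr>"

definition rset :: "nat \<Rightarrow> real \<Rightarrow> state \<Rightarrow> state" where
  "rset a x s = s\<lparr>rmem := (rmem s)(a := x)\<rparr>"

definition tick :: "nat \<Rightarrow> state \<Rightarrow> state" where
  "tick c s = s\<lparr>clock := clock s + c\<rparr>"

definition write_block :: "(nat \<Rightarrow> 'a) \<Rightarrow> nat \<Rightarrow> 'a list \<Rightarrow> nat \<Rightarrow> 'a" where
  "write_block m a xs = (\<lambda>i. if a \<le> i \<and> i < a + length xs then xs ! (i - a) else m i)"

definition nonzeros :: "real vec \<Rightarrow> nat list" where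
  "nonzeros v = filter (\<lambda>i. v $ i \<noteq> 0) [0..<dim_vec v]"

text \<open>Stores the number of nonzero entries of \<open>v\<close> in natural cell \<open>a\<close>, their indices in the natural
  cells from \<open>a + 1\<close> on and their values in the real cells from \<open>a + 1\<close> on.\<close>

definition put_nonzeros :: "nat \<Rightarrow> real vec \<Rightarrow> state \<Rightarrow> state" where
  "put_nonzeros a v s =
     s\<lparr>nmem := write_block (nmem s) a (length (nonzeros v) # nonzeros v),
       rmem := write_block (rmem s) (a + 1) (map (\<lambda>i. v $ i) (nonzeros v))\<rparr>"

definition row_of :: "lin_sys \<Rightarrow> nat \<Rightarrow> real vec" where
  "row_of S j = (if j < dim_row (mtx S) then row (mtx S) j else 0\<^sub>v 0)"

definition col_of :: "lin_sys \<Rightarrow> nat \<Rightarrow> real vec" where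
  "col_of S j = (if j < dim_col (mtx S) then col (mtx S) j else 0\<^sub>v 0)"

fun instr_time :: "lin_sys \<Rightarrow> instr \<Rightarrow> state \<Rightarrow> nat" where
  "instr_time S (ReadRow a j) s = 1 + norm0 (row_of S (nmem s j))"
| "instr_time S (ReadCol a j) s = 1 + norm0 (col_of S (nmem s j))"
| "instr_time S (WalkStep a j) s =
     (if nmem s j < dim_row (mtx S) then step_time S (nmem s j) else 1)"
| "instr_time S _ s = 1"

fun instr_sem :: "lin_sys \<Rightarrow> instr \<Rightarrow> state \<Rightarrow> state pmf" where
  "instr_sem S (NConst a k) s = return_pmf (nset a k s)"
| "instr_sem S (NAdd a i j) s = return_pmf (nset a (nmem s i + nmem s j) s)"
| "instr_sem S (NSub a i j) s = return_pmf (nset a (nmem s i - nmem s j) s)"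
| "instr_sem S (NLoad a i) s = return_pmf (nset a (nmem s (nmem s i)) s)"
| "instr_sem S (NStore a i) s = return_pmf (nset (nmem s a) (nmem s i) s)"
| "instr_sem S (RofN a i) s = return_pmf (rset a (real (nmem s i)) s)"
| "instr_sem S (RAdd a i j) s = return_pmf (rset a (rmem s i + rmem s j) s)"
| "instr_sem S (RSub a i j) s = return_pmf (rset a (rmem s i - rmem s j) s)"
| "instr_sem S (RMul a i j) s = return_pmf (rset a (rmem s i * rmem s j) s)"
| "instr_sem S (RDiv a i j) s = return_pmf (rset a (rmem s i / rmem s j) s)"
| "instr_sem S (RLoad a i) s = return_pmf (rset a (rmem s (nmem s i)) s)"
| "instr_sem S (RStore a i) s = return_pmf (rset (nmem s a) (rmem s i) s)"
| "instr_sem S (Flip a) s = map_pmf (\<lambda>k. nset a k s) (pmf_of_set {0, 1})"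
| "instr_sem S (ReadDiag a j) s =
     return_pmf (rset a (if nmem s j < dim_row (mtx S) then mtx S $$ (nmem s j, nmem s j) else 0) s)"
| "instr_sem S (ReadRow a j) s = return_pmf (put_nonzeros (nmem s a) (row_of S (nmem s j)) s)"
| "instr_sem S (ReadCol a j) s = return_pmf (put_nonzeros (nmem s a) (col_of S (nmem s j)) s)"
| "instr_sem S (ReadB a j) s =
     return_pmf (rset a (if nmem s j < dim_vec (rhs S) then rhs S $ nmem s j else 0) s)"
| "instr_sem S (ReadT a j) s =
     return_pmf (rset a (if nmem s j < dim_vec (tgt S) then tgt S $ nmem s j else 0) s)"
| "instr_sem S (SampleT a) s = map_pmf (\<lambda>k. nset a k s) (vec_sample (tgt S))"
| "instr_sem S (WalkStep a j) s = map_pmf (\<lambda>k. nset a k s) (walk_step (mtx S) (nmem s j))"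

fun test_sem :: "test \<Rightarrow> state \<Rightarrow> bool" where
  "test_sem (NLess i j) s \<longleftrightarrow> nmem s i < nmem s j"
| "test_sem (NEq i j) s \<longleftrightarrow> nmem s i = nmem s j"
| "test_sem (RLess i j) s \<longleftrightarrow> rmem s i < rmem s j"

partial_function (spmf) while_spmf ::
    "('s \<Rightarrow> bool) \<Rightarrow> ('s \<Rightarrow> 's spmf) \<Rightarrow> 's \<Rightarrow> 's spmf" where
  "while_spmf g body s =
     (if g s then bind_spmf (body s) (while_spmf g body) else return_spmf s)"

text \<open>Every evaluation of a test takes one unit of time, including the last one of a loop. Mass
  missing from the result is the probability of nontermination.\<close>

primrec exec :: "lin_sys \<Rightarrow> prog \<Rightarrow> state \<Rightarrow> state spmf" where
  "exec S (Do i) = (\<lambda>s. spmf_of_pmf (map_pmf (tick (instr_time S i s)) (instr_sem S i s)))"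
| "exec S (Seq P Q) = (\<lambda>s. bind_spmf (exec S P s) (exec S Q))"
| "exec S (If c P Q) = (\<lambda>s. if test_sem c s then exec S P (tick 1 s) else exec S Q (tick 1 s))"
| "exec S (While c P) =
     (\<lambda>s. map_spmf (tick 1) (while_spmf (test_sem c) (\<lambda>s. exec S P (tick 1 s)) s))"

text \<open>The parameters known to the algorithm: \<open>n\<close>, \<open>L\<close>, \<open>\<epsilon>\<close>, \<open>\<gamma>\<close> and the norm of \<open>t\<close>. Everything
  else is accessible through the instructions only.\<close>

definition initial :: "lin_sys \<Rightarrow> nat \<Rightarrow> real \<Rightarrow> real \<Rightarrow> state" where
  "initial S L \<epsilon> \<gamma> =
     \<lparr>nmem = (\<lambda>_. 0)(0 := dim_row (mtx S), 1 := L),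
      rmem = (\<lambda>_. 0)(0 := \<epsilon>, 1 := \<gamma>, 2 := p_norm 1 (tgt S)),
      clock = 0\<rparr>"

definition result :: "state \<Rightarrow> real" where
  "result s = rmem s 0"

end

theory Submission
  imports Defs
begin

text \<open>Up to the factor 1/2, the vector \<open>x\<^sup>*\<close> is the expected total reward of the terminating lazy walk
  that collects \<open>b\<^sub>v / M\<^sub>v\<^sub>v\<close> at every visited vertex \<open>v\<close>. The program averages this reward over
  \<open>128 \<parallel>t\<parallel>\<^sub>1\<^sup>2 / \<epsilon>\<^sup>2\<close> walks of length \<open>O(L)\<close> with starting vertices drawn from \<open>t\<close>; if
  \<open>\<parallel>t\<parallel>\<^sub>1 \<le> \<epsilon>\<close>, then 0 is already accurate enough.

  Truncation costs at most \<open>3/4 \<epsilon> \<parallel>x\<^sup>*\<parallel>\<^sub>\<infinity>\<close>. For a \<open>p\<close> that almost attains \<open>\<gamma>\<^sub>m\<^sub>a\<^sub>x\<close>, the lazy matrix is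
  conjugate by a power of the diagonal to one that contracts the \<open>p\<close>-norm on a subspace containing
  the conjugated right-hand side. The \<open>p\<close>-norm lies between the maximum norm and the 1-norm, which
  turns this contraction into entrywise decay. The sampling error is controlled by Chebyshev's inequality: the
  second moment of the reward of one walk is at most \<open>2 (2 \<parallel>x\<^sup>*\<parallel>\<^sub>\<infinity>)\<^sup>2\<close>, independently of its length.\<close>

section \<open>Iterated probabilistic steps\<close>

lemma expectation_bind_pmf_finite:
  fixes h :: "'b \<Rightarrow> real"
  assumes "finite (set_pmf p)" and "\<And>x. x \<in> set_pmf p \<Longrightarrow> finite (set_pmf (f x))"
  shows "measure_pmf.expectation (bind_pmf p f) h
    = measure_pmf.expectation p (\<lambda>x. measure_pmf.expectation (f x) h)"
proof -
  have "measure_pmf.expectation (bind_pmf p f) h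
      = (\<Sum>a\<in>set_pmf p. pmf p a *\<^sub>R measure_pmf.expectation (f a) h)"
    using assms by (intro pmf_expectation_bind) auto
  also have "\<dots> = measure_pmf.expectation p (\<lambda>x. measure_pmf.expectation (f x) h)"
    using assms(1) by (subst integral_measure_pmf_real[of "set_pmf p"]) (auto simp: mult.commute)
  finally show ?thesis .
qed

lemma expectation_mono_pmf_finite:
  fixes f g :: "'a \<Rightarrow> real"
  assumes "finite (set_pmf p)" and "\<And>x. x \<in> set_pmf p \<Longrightarrow> f x \<le> g x"
  shows "measure_pmf.expectation p f \<le> measure_pmf.expectation p g"
  using assms by (intro integral_mono_AE integrable_measure_pmf_finite) (auto simp: AE_measure_pmf_iff)

lemma expectation_cong_pmf:
  fixes f g :: "'a \<Rightarrow> real"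
  assumes "\<And>x. x \<in> set_pmf p \<Longrightarrow> f x = g x"
  shows "measure_pmf.expectation p f = measure_pmf.expectation p g"
  using assms by (intro integral_cong_AE) (auto simp: AE_measure_pmf_iff)

lemma expectation_add_pmf_finite:
  fixes f g :: "'a \<Rightarrow> real"
  assumes "finite (set_pmf p)"
  shows "measure_pmf.expectation p (\<lambda>x. f x + g x)
    = measure_pmf.expectation p f + measure_pmf.expectation p g"
  using assms by (intro Bochner_Integration.integral_add integrable_measure_pmf_finite)

lemma expectation_diff_pmf_finite:
  fixes f g :: "'a \<Rightarrow> real"
  assumes "finite (set_pmf p)"
  shows "measure_pmf.expectation p (\<lambda>x. f x - g x)
    = measure_pmf.expectation p f - measure_pmf.expectation p g"
  using assms by (intro Bochner_Integration.integral_diff integrable_measure_pmf_finite)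

lemma expectation_square_shift:
  fixes f :: "'a \<Rightarrow> real"
  assumes "finite (set_pmf p)"
  shows "measure_pmf.expectation p (\<lambda>x. (f x + a)\<^sup>2)
    = measure_pmf.expectation p (\<lambda>x. (f x)\<^sup>2) + 2 * a * measure_pmf.expectation p f + a\<^sup>2"
proof -
  have "(\<lambda>x. (f x + a)\<^sup>2) = (\<lambda>x. (f x)\<^sup>2 + (2 * a * f x + a\<^sup>2))"
    by (auto simp: power2_eq_square algebra_simps)
  then show ?thesis
    by (simp add: expectation_add_pmf_finite[OF assms])
qed

section \<open>Loops with a fixed number of iterations\<close>

primrec iter_pmf :: "nat \<Rightarrow> ('s \<Rightarrow> 's pmf) \<Rightarrow> 's \<Rightarrow> 's pmf" where
  "iter_pmf 0 f s = return_pmf s"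
| "iter_pmf (Suc m) f s = bind_pmf (f s) (iter_pmf m f)"

text \<open>The index of the invariant \<open>I\<close> is the number of iterations still to run.
  Since it decides the test, the loop unrolls into finitely many steps and no probability mass is
  lost.\<close>

lemma while_spmf_eq_iter_pmf:
  assumes "\<And>s. I 0 s \<Longrightarrow> \<not> g s"
    and "\<And>m s. I (Suc m) s \<Longrightarrow> g s \<and> body s = spmf_of_pmf (f s)"
    and "\<And>m s s'. I (Suc m) s \<Longrightarrow> s' \<in> set_pmf (f s) \<Longrightarrow> I m s'"
    and "I m s"
  shows "while_spmf g body s = spmf_of_pmf (iter_pmf m f s)"
  using assms(4)
proof (induction m arbitrary: s)
  case 0
  then show ?case
    using assms(1) by (subst while_spmf.simps) simp
next
  case (Suc m)
  have "while_spmf g body s = bind_pmf (f s) (while_spmf g body)"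
    using assms(2)[OF Suc.prems] by (subst while_spmf.simps) simp
  also have "\<dots> = bind_pmf (f s) (\<lambda>s. spmf_of_pmf (iter_pmf m f s))"
    using Suc assms(3) by (intro bind_pmf_cong) auto
  finally show ?case
    by (simp add: spmf_of_pmf_bind)
qed

lemma iter_pmf_invariant:
  assumes "\<And>m s s'. I (Suc m) s \<Longrightarrow> s' \<in> set_pmf (f s) \<Longrightarrow> I m s'"
    and "I m s" and "s' \<in> set_pmf (iter_pmf m f s)"
  shows "I 0 s'"
  using assms(2,3) by (induction m arbitrary: s) (auto dest: assms(1))

lemma finite_set_iter_pmf:
  assumes "\<And>s. finite (set_pmf (f s))"
  shows "finite (set_pmf (iter_pmf m f s))"
  by (induction m arbitrary: s) (use assms in auto)

text \<open>The increments of \<open>d\<close> behave like uncorrelated variables with mean \<open>\<mu>\<close> and variance at most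
  \<open>v\<close>, because these hold conditionally on the past.\<close>

lemma iter_pmf_mean_variance:
  fixes d :: "'s \<Rightarrow> real"
  assumes fin: "\<And>s. finite (set_pmf (f s))"
    and inv: "\<And>m s s'. I (Suc m) s \<Longrightarrow> s' \<in> set_pmf (f s) \<Longrightarrow> I m s'"
    and mean: "\<And>m s. I (Suc m) s \<Longrightarrow> measure_pmf.expectation (f s) (\<lambda>s'. d s' - d s) = \<mu>"
    and var: "\<And>m s. I (Suc m) s \<Longrightarrow> measure_pmf.expectation (f s) (\<lambda>s'. (d s' - d s - \<mu>)\<^sup>2) \<le> v"
    and "I m s"
  shows "measure_pmf.expectation (iter_pmf m f s) (\<lambda>s'. d s' - d s - real m * \<mu>) = 0"
    and "measure_pmf.expectation (iter_pmf m f s) (\<lambda>s'. (d s' - d s - real m * \<mu>)\<^sup>2) \<le> real m * v"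
proof -
  have "measure_pmf.expectation (iter_pmf m f s) (\<lambda>s'. d s' - d s - real m * \<mu>) = 0 \<and>
    measure_pmf.expectation (iter_pmf m f s) (\<lambda>s'. (d s' - d s - real m * \<mu>)\<^sup>2) \<le> real m * v"
    using \<open>I m s\<close>
  proof (induction m arbitrary: s)
    case 0
    then show ?case by simp
  next
    case (Suc m)
    \<comment> \<open>Split off the first step: \<open>a\<close> is its deviation from the mean and
      \<open>e\<close> that of the remaining \<open>m\<close> steps. Given \<open>s1\<close>,
      \<open>e\<close> has mean 0, so the cross term of the square vanishes.\<close>
    define e where "e s1 s' = d s' - d s1 - real m * \<mu>" for s1 s'
    define a where "a s1 = d s1 - d s - \<mu>" for s1
    have split: "d s' - d s - real (Suc m) * \<mu> = e s1 s' + a s1" for s1 s'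
      by (simp add: e_def a_def algebra_simps)
    have fin_it: "finite (set_pmf (iter_pmf m f s1))" for s1
      using fin by (rule finite_set_iter_pmf)
    have IH: "measure_pmf.expectation (iter_pmf m f s1) (e s1) = 0"
      "measure_pmf.expectation (iter_pmf m f s1) (\<lambda>s'. (e s1 s')\<^sup>2) \<le> real m * v"
      if "s1 \<in> set_pmf (f s)" for s1
      using Suc.IH[of s1] inv[OF Suc.prems that] by (auto simp: e_def[abs_def])
    have "measure_pmf.expectation (iter_pmf (Suc m) f s) (\<lambda>s'. d s' - d s - real (Suc m) * \<mu>)
        = measure_pmf.expectation (f s) (\<lambda>s1. measure_pmf.expectation (iter_pmf m f s1)
            (\<lambda>s'. e s1 s' + a s1))"
      unfolding split[symmetric] iter_pmf.simps
      using fin fin_it by (intro expectation_bind_pmf_finite) auto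
    also have "\<dots> = measure_pmf.expectation (f s) a"
      using IH by (intro expectation_cong_pmf) (simp add: expectation_add_pmf_finite fin_it)
    also have "\<dots> = 0"
      using mean[OF Suc.prems] unfolding a_def
      by (subst expectation_diff_pmf_finite) (auto simp: fin)
    finally have 1: "measure_pmf.expectation (iter_pmf (Suc m) f s)
      (\<lambda>s'. d s' - d s - real (Suc m) * \<mu>) = 0" .
    have "measure_pmf.expectation (iter_pmf (Suc m) f s) (\<lambda>s'. (d s' - d s - real (Suc m) * \<mu>)\<^sup>2)
        = measure_pmf.expectation (f s) (\<lambda>s1. measure_pmf.expectation (iter_pmf m f s1)
            (\<lambda>s'. (e s1 s' + a s1)\<^sup>2))"
      unfolding split[symmetric] iter_pmf.simps
      using fin fin_it by (intro expectation_bind_pmf_finite) auto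
    also have "\<dots> \<le> measure_pmf.expectation (f s) (\<lambda>s1. real m * v + (a s1)\<^sup>2)"
      using IH by (intro expectation_mono_pmf_finite fin)
        (simp add: expectation_square_shift fin_it)
    also have "\<dots> \<le> real m * v + v"
      using var[OF Suc.prems] by (simp add: expectation_add_pmf_finite fin a_def)
    finally show ?case
      using 1 by (simp add: algebra_simps)
  qed
  then show "measure_pmf.expectation (iter_pmf m f s) (\<lambda>s'. d s' - d s - real m * \<mu>) = 0"
    and "measure_pmf.expectation (iter_pmf m f s) (\<lambda>s'. (d s' - d s - real m * \<mu>)\<^sup>2) \<le> real m * v"
    by auto
qed

section \<open>Mean and second moment of the reward of a walk\<close>

primrec walk_reward :: "('v \<Rightarrow> 'v pmf) \<Rightarrow> ('v \<Rightarrow> real) \<Rightarrow> nat \<Rightarrow> 'v \<Rightarrow> real" where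
  "walk_reward K y 0 v = 0"
| "walk_reward K y (Suc m) v = y v + measure_pmf.expectation (K v) (walk_reward K y m)"

text \<open>The second moment is linear rather than quadratic in the total reward: expanding the square
  along the first step, the cross term pairs \<open>y v\<close> with the expected reward still to come, which is
  at most \<open>X\<close>.\<close>

lemma iter_pmf_walk_reward:
  fixes d :: "'s \<Rightarrow> real"
  assumes fin: "\<And>s. finite (set_pmf (f s))"
    and pos: "\<And>s. map_pmf pos (f s) = K (pos s)"
    and d: "\<And>s s'. s' \<in> set_pmf (f s) \<Longrightarrow> d s' = d s + y (pos s)"
    and y: "\<And>v. 0 \<le> y v"
    and X: "\<And>m v. walk_reward K y m v \<le> X"
  shows "measure_pmf.expectation (iter_pmf m f s) (\<lambda>s'. d s' - d s) = walk_reward K y m (pos s)"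
    and "measure_pmf.expectation (iter_pmf m f s) (\<lambda>s'. (d s' - d s)\<^sup>2)
      \<le> 2 * X * walk_reward K y m (pos s)"
proof -
  have "measure_pmf.expectation (iter_pmf m f s) (\<lambda>s'. d s' - d s) = walk_reward K y m (pos s) \<and>
    measure_pmf.expectation (iter_pmf m f s) (\<lambda>s'. (d s' - d s)\<^sup>2)
      \<le> 2 * X * walk_reward K y m (pos s)"
  proof (induction m arbitrary: s)
    case 0
    then show ?case by simp
  next
    case (Suc m)
    let ?u = "walk_reward K y m" and ?y = "y (pos s)"
    have fin_it: "finite (set_pmf (iter_pmf m f s1))" for s1
      using fin by (rule finite_set_iter_pmf)
    have u: "measure_pmf.expectation (f s) (\<lambda>s1. ?u (pos s1))
        = walk_reward K y (Suc m) (pos s) - ?y"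
      by (simp flip: pos)
    have "measure_pmf.expectation (iter_pmf (Suc m) f s) (\<lambda>s'. d s' - d s)
        = measure_pmf.expectation (f s) (\<lambda>s1. measure_pmf.expectation (iter_pmf m f s1)
            (\<lambda>s'. d s' - d s))"
      unfolding iter_pmf.simps using fin fin_it by (intro expectation_bind_pmf_finite) auto
    also have "\<dots> = measure_pmf.expectation (f s) (\<lambda>s1. ?u (pos s1) + ?y)"
    proof (rule expectation_cong_pmf)
      fix s1 assume "s1 \<in> set_pmf (f s)"
      then have "(\<lambda>s'. d s' - d s) = (\<lambda>s'. (d s' - d s1) + ?y)"
        by (auto simp: d)
      then show "measure_pmf.expectation (iter_pmf m f s1) (\<lambda>s'. d s' - d s) = ?u (pos s1) + ?y"
        using Suc.IH[of s1] by (simp only: expectation_add_pmf_finite fin_it) simp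
    qed
    also have "\<dots> = walk_reward K y (Suc m) (pos s)"
      by (simp add: expectation_add_pmf_finite fin u del: walk_reward.simps)
    finally have 1: "measure_pmf.expectation (iter_pmf (Suc m) f s) (\<lambda>s'. d s' - d s)
      = walk_reward K y (Suc m) (pos s)" .
    have "measure_pmf.expectation (iter_pmf (Suc m) f s) (\<lambda>s'. (d s' - d s)\<^sup>2)
        = measure_pmf.expectation (f s) (\<lambda>s1. measure_pmf.expectation (iter_pmf m f s1)
            (\<lambda>s'. (d s' - d s)\<^sup>2))"
      unfolding iter_pmf.simps using fin fin_it by (intro expectation_bind_pmf_finite) auto
    also have "\<dots> \<le> measure_pmf.expectation (f s) (\<lambda>s1. (2 * X + 2 * ?y) * ?u (pos s1) + ?y\<^sup>2)"
    proof (intro expectation_mono_pmf_finite fin)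
      fix s1 assume "s1 \<in> set_pmf (f s)"
      then have "(\<lambda>s'. (d s' - d s)\<^sup>2) = (\<lambda>s'. ((d s' - d s1) + ?y)\<^sup>2)"
        by (auto simp: d)
      then show "measure_pmf.expectation (iter_pmf m f s1) (\<lambda>s'. (d s' - d s)\<^sup>2)
          \<le> (2 * X + 2 * ?y) * ?u (pos s1) + ?y\<^sup>2"
        using Suc.IH[of s1]
        by (simp only: expectation_square_shift fin_it) (simp add: algebra_simps)
    qed
    also have "\<dots> = (2 * X + 2 * ?y) * (walk_reward K y (Suc m) (pos s) - ?y) + ?y\<^sup>2"
      by (simp add: expectation_add_pmf_finite fin u del: walk_reward.simps)
    also have "\<dots> \<le> 2 * X * walk_reward K y (Suc m) (pos s)"
    proof -
      \<comment> \<open>The reward still to come is the total reward \<open>w\<close> minus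
        \<open>?y\<close>. This subtraction turns the surplus \<open>?y\<^sup>2\<close> into the
        deficit \<open>- ?y\<^sup>2\<close> below.\<close>
      have "?y * walk_reward K y (Suc m) (pos s) \<le> ?y * X"
        by (rule mult_left_mono[OF X y])
      moreover have "(2 * X + 2 * ?y) * (w - ?y) + ?y\<^sup>2 = 2 * X * w + 2 * (?y * w - ?y * X) - ?y\<^sup>2"
        for w
        by (simp add: power2_eq_square algebra_simps)
      moreover have "0 \<le> ?y\<^sup>2" by simp
      ultimately show ?thesis by (smt (verit))
    qed
    finally show ?case
      using 1 by blast
  qed
  then show "measure_pmf.expectation (iter_pmf m f s) (\<lambda>s'. d s' - d s) = walk_reward K y m (pos s)"
    and "measure_pmf.expectation (iter_pmf m f s) (\<lambda>s'. (d s' - d s)\<^sup>2)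
      \<le> 2 * X * walk_reward K y m (pos s)"
    by auto
qed

lemma expectation_embed_pmf_finite:
  fixes f h :: "'a \<Rightarrow> real"
  assumes "finite A" and "\<And>x. 0 \<le> f x" and "\<And>x. x \<notin> A \<Longrightarrow> f x = 0" and "sum f A = 1"
  shows "finite (set_pmf (embed_pmf f))"
    and "set_pmf (embed_pmf f) \<subseteq> A"
    and "measure_pmf.expectation (embed_pmf f) h = (\<Sum>a\<in>A. f a * h a)"
proof -
  have "(\<integral>\<^sup>+x. ennreal (f x) \<partial>count_space UNIV) = (\<Sum>a\<in>A. ennreal (f a))"
    using assms(1,3) by (intro nn_integral_count_space') auto
  also have "\<dots> = 1"
    using assms by (simp add: sum_ennreal)
  finally have nn: "(\<integral>\<^sup>+x. ennreal (f x) \<partial>count_space UNIV) = 1" .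
  have pmf: "pmf (embed_pmf f) x = f x" for x
    using assms(2) nn by (rule pmf_embed_pmf)
  show sub: "set_pmf (embed_pmf f) \<subseteq> A"
    using assms(3) by (auto simp: set_pmf_eq pmf)
  then show "finite (set_pmf (embed_pmf f))"
    using assms(1) by (rule finite_subset)
  show "measure_pmf.expectation (embed_pmf f) h = (\<Sum>a\<in>A. f a * h a)"
    using assms(1) sub by (subst integral_measure_pmf_real[of A]) (auto simp: pmf mult.commute)
qed

section \<open>The operator norms and the powers of the lazy matrix\<close>

lemma p_norm_1: "p_norm 1 v = (\<Sum>i<dim_vec v. \<bar>v $ i\<bar>)"
  by (simp add: p_norm_def sum_nonneg)

lemma ereal_ge_1_cases:
  assumes "(1 :: ereal) \<le> p"
  obtains "p = \<infinity>" | r where "p = ereal r" "1 \<le> r"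
  using assms by (cases p) auto

lemma abs_le_p_norm:
  assumes "1 \<le> p" and "i < dim_vec v"
  shows "\<bar>v $ i\<bar> \<le> p_norm p v"
  using assms(1)
proof (cases rule: ereal_ge_1_cases)
  case 1
  then show ?thesis
    using assms(2) by (auto simp: p_norm_def intro!: Max_ge)
next
  case (2 r)
  have "\<bar>v $ i\<bar> = (\<bar>v $ i\<bar> powr r) powr (1 / r)"
    using 2 by (simp add: powr_powr)
  also have "\<dots> \<le> (\<Sum>i<dim_vec v. \<bar>v $ i\<bar> powr r) powr (1 / r)"
    using 2 assms(2) by (intro powr_mono2 member_le_sum) auto
  finally show ?thesis
    using 2 by (simp add: p_norm_def)
qed

text \<open>With \<open>T\<close> the 1-norm, every entry satisfies |v_i|^r <= |v_i| * T^(r-1), and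
  these bounds add up to T^r. The dimension is positive because \<open>MAX\<close> over the empty
  set is unspecified.\<close>

lemma p_norm_le_sum:
  assumes "1 \<le> p" and "0 < dim_vec v"
  shows "p_norm p v \<le> (\<Sum>i<dim_vec v. \<bar>v $ i\<bar>)"
  using assms(1)
proof (cases rule: ereal_ge_1_cases)
  case 1
  then show ?thesis
    using assms(2) by (auto simp: p_norm_def intro!: Max.boundedI member_le_sum)
next
  case (2 r)
  define T where "T = (\<Sum>i<dim_vec v. \<bar>v $ i\<bar>)"
  have T: "0 \<le> T"
    by (simp add: T_def sum_nonneg)
  have "\<bar>v $ i\<bar> powr r \<le> \<bar>v $ i\<bar> * T powr (r - 1)" if "i < dim_vec v" for i
  proof (cases "v $ i = 0")
    case False
    have "\<bar>v $ i\<bar> \<le> T"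
      unfolding T_def using that by (intro member_le_sum) auto
    then have "\<bar>v $ i\<bar> powr (r - 1) \<le> T powr (r - 1)"
      using 2 by (intro powr_mono2) auto
    then have "\<bar>v $ i\<bar> * \<bar>v $ i\<bar> powr (r - 1) \<le> \<bar>v $ i\<bar> * T powr (r - 1)"
      by (intro mult_left_mono) auto
    also have "\<bar>v $ i\<bar> * \<bar>v $ i\<bar> powr (r - 1) = \<bar>v $ i\<bar> powr r"
      using False by (simp add: powr_mult_base)
    finally show ?thesis .
  qed simp
  then have "(\<Sum>i<dim_vec v. \<bar>v $ i\<bar> powr r) \<le> (\<Sum>i<dim_vec v. \<bar>v $ i\<bar> * T powr (r - 1))"
    by (intro sum_mono) auto
  also have "\<dots> = T * T powr (r - 1)"
    by (simp add: T_def sum_distrib_right)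
  also have "\<dots> = T powr r"
    using T by (simp add: powr_mult_base)
  finally have "(\<Sum>i<dim_vec v. \<bar>v $ i\<bar> powr r) powr (1 / r) \<le> (T powr r) powr (1 / r)"
    using 2 by (intro powr_mono2 sum_nonneg) auto
  also have "\<dots> = T"
    using 2 T by (simp add: powr_powr)
  finally show ?thesis
    using 2 by (simp add: p_norm_def T_def)
qed

lemma p_norm_nonneg:
  assumes "1 \<le> p" and "0 < dim_vec v"
  shows "0 \<le> p_norm p v"
  using abs_le_p_norm[OF assms] by linarith

lemma p_norm_pos:
  assumes "1 \<le> p" and "v \<noteq> 0\<^sub>v (dim_vec v)"
  shows "0 < p_norm p v"
proof -
  obtain i where "i < dim_vec v" "v $ i \<noteq> 0"
    using assms(2) by (auto simp: vec_eq_iff)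
  then show ?thesis
    using abs_le_p_norm[OF assms(1), of i v] by linarith
qed

lemma p_norm_zero:
  assumes "1 \<le> p" and "0 < n"
  shows "p_norm p (0\<^sub>v n) = 0"
  using p_norm_le_sum[OF assms(1), of "0\<^sub>v n"] p_norm_nonneg[OF assms(1), of "0\<^sub>v n"] assms(2)
  by simp

lemma p_norm_infinity_le:
  assumes "0 < dim_vec v" and "\<And>i. i < dim_vec v \<Longrightarrow> \<bar>v $ i\<bar> \<le> c"
  shows "p_norm \<infinity> v \<le> c"
  using assms by (auto simp: p_norm_def intro!: Max.boundedI)

lemma norm0_pos:
  assumes "v \<noteq> 0\<^sub>v (dim_vec v)"
  shows "0 < norm0 v"
  using assms by (auto simp: norm0_def card_gt_0_iff vec_eq_iff)

lemma norm0_le: "norm0 v \<le> dim_vec v"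
  unfolding norm0_def by (rule order_trans[OF card_mono[of "{..<dim_vec v}"]]) auto

section \<open>The norm of a matrix on a subspace\<close>

lemma bdd_above_restricted_norm:
  assumes A: "A \<in> carrier_mat n n" and S: "S \<subseteq> carrier_vec n" and p: "1 \<le> p"
  shows "bdd_above (insert 0
    {p_norm p (A *\<^sub>v v) / p_norm p v | v. v \<in> S \<and> v \<noteq> 0\<^sub>v (dim_vec v)})"
proof -
  define C where "C = (\<Sum>i<n. \<Sum>j<n. \<bar>A $$ (i, j)\<bar>)"
  have "p_norm p (A *\<^sub>v v) / p_norm p v \<le> C" if v: "v \<in> S" "v \<noteq> 0\<^sub>v (dim_vec v)" for v
  proof -
    have dim: "dim_vec v = n" "0 < n"
      using v S by (auto simp: vec_eq_iff)
    have pos: "0 < p_norm p v"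
      using p_norm_pos[OF p v(2)] .
    have "p_norm p (A *\<^sub>v v) \<le> (\<Sum>i<n. \<bar>(A *\<^sub>v v) $ i\<bar>)"
      using p_norm_le_sum[OF p, of "A *\<^sub>v v"] A dim by simp
    also have "\<dots> \<le> (\<Sum>i<n. \<Sum>j<n. \<bar>A $$ (i, j)\<bar> * p_norm p v)"
    proof (intro sum_mono)
      fix i assume "i \<in> {..<n}"
      then have "\<bar>(A *\<^sub>v v) $ i\<bar> \<le> (\<Sum>j<n. \<bar>A $$ (i, j) * v $ j\<bar>)"
        using A dim by (auto simp: scalar_prod_def atLeast0LessThan)
      also have "\<dots> \<le> (\<Sum>j<n. \<bar>A $$ (i, j)\<bar> * p_norm p v)"
        unfolding abs_mult using dim by (intro sum_mono mult_left_mono abs_le_p_norm p) auto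
      finally show "\<bar>(A *\<^sub>v v) $ i\<bar> \<le> (\<Sum>j<n. \<bar>A $$ (i, j)\<bar> * p_norm p v)" .
    qed
    also have "\<dots> = C * p_norm p v"
      by (simp add: C_def sum_distrib_right)
    finally show ?thesis
      using pos by (simp add: field_simps)
  qed
  then show ?thesis
    by (auto simp: bdd_above_insert intro!: bdd_aboveI[of _ C])
qed

lemma restricted_norm_nonneg:
  assumes "A \<in> carrier_mat n n" and "S \<subseteq> carrier_vec n" and "1 \<le> p"
  shows "0 \<le> restricted_norm p A S"
  unfolding restricted_norm_def by (rule cSup_upper[OF _ bdd_above_restricted_norm[OF assms]]) simp

lemma p_norm_mult_le_restricted_norm:
  assumes "A \<in> carrier_mat n n" and "S \<subseteq> carrier_vec n" and "1 \<le> p" and "0 < n" and "v \<in> S"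
  shows "p_norm p (A *\<^sub>v v) \<le> restricted_norm p A S * p_norm p v"
proof (cases "v = 0\<^sub>v (dim_vec v)")
  case True
  have v: "v = 0\<^sub>v n"
    using True assms by (metis carrier_vecD subsetD)
  have "A *\<^sub>v v = 0\<^sub>v n"
    using assms(1) unfolding v by (intro eq_vecI) auto
  then show ?thesis
    using p_norm_zero[OF assms(3,4)] by (simp add: v)
next
  case False
  have "p_norm p (A *\<^sub>v v) / p_norm p v \<le> restricted_norm p A S"
    unfolding restricted_norm_def
    using False assms(5) by (intro cSup_upper bdd_above_restricted_norm[OF assms(1-3)]) auto
  then show ?thesis
    using p_norm_pos[OF assms(3) False] by (simp add: field_simps)
qed

text \<open>Invariance of the subspace keeps all iterates where the restricted norm controls them,
  so each application costs one factor.\<close>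

lemma restricted_norm_power:
  assumes "A \<in> carrier_mat n n" and "S \<subseteq> carrier_vec n" and "1 \<le> p" and "0 < n"
    and v: "v 0 \<in> S" "\<And>l. v (Suc l) = A *\<^sub>v v l" and S: "\<And>u. u \<in> S \<Longrightarrow> A *\<^sub>v u \<in> S"
  shows "p_norm p (v l) \<le> restricted_norm p A S ^ l * p_norm p (v 0)"
proof (induction l)
  case 0
  show ?case by simp
next
  case (Suc l)
  have "v l \<in> S"
    by (induction l) (auto simp: v S)
  then have "p_norm p (v (Suc l)) \<le> restricted_norm p A S * p_norm p (v l)"
    using p_norm_mult_le_restricted_norm[OF assms(1-4)] by (simp add: v)
  also have "\<dots> \<le> restricted_norm p A S * (restricted_norm p A S ^ l * p_norm p (v 0))"
    using Suc restricted_norm_nonneg[OF assms(1-3)] by (intro mult_left_mono) auto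
  finally show ?case by (simp add: algebra_simps)
qed

section \<open>Scaling by powers of the diagonal\<close>

lemma diag_powr_carrier [simp]:
  "M \<in> carrier_mat n n \<Longrightarrow> diag_powr M s \<in> carrier_mat n n"
  by (simp add: diag_powr_def)

lemma diag_powr_dim [simp]: "dim_row (diag_powr M s) = dim_row M" "dim_col (diag_powr M s) = dim_row M"
  by (simp_all add: diag_powr_def)

lemma AT_carrier [simp]: "M \<in> carrier_mat n n \<Longrightarrow> AT M \<in> carrier_mat n n"
  by (auto simp: AT_def intro!: minus_carrier_mat)

lemma AT_index:
  "M \<in> carrier_mat n n \<Longrightarrow> i < n \<Longrightarrow> j < n \<Longrightarrow> AT M $$ (i, j) = (if i = j then 0 else - M $$ (i, j))"
  by (auto simp: AT_def diag_part_def)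

lemma sum_delta_mult_left:
  fixes f :: "'a \<Rightarrow> 'b :: semiring_0"
  assumes "finite A" and "i \<in> A"
  shows "(\<Sum>k\<in>A. (if i = k then c else 0) * f k) = c * f i"
  using assms by (subst sum.cong[OF refl, of _ _ "\<lambda>k. if i = k then c * f k else 0"]) auto

lemma diag_powr_mult_index:
  assumes "M \<in> carrier_mat n n" "A \<in> carrier_mat n n" "i < n" "j < n"
  shows "(diag_powr M s * A) $$ (i, j) = M $$ (i, i) powr s * A $$ (i, j)"
  using assms by (simp add: diag_powr_def scalar_prod_def sum_delta_mult_left atLeast0LessThan)

lemma mult_diag_powr_index:
  assumes "M \<in> carrier_mat n n" "A \<in> carrier_mat n n" "i < n" "j < n"
  shows "(A * diag_powr M s) $$ (i, j) = A $$ (i, j) * M $$ (j, j) powr s"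
proof -
  have "(\<Sum>k<n. A $$ (i, k) * (if k = j then M $$ (k, k) powr s else 0))
      = (\<Sum>k<n. if k = j then A $$ (i, k) * M $$ (k, k) powr s else 0)"
    by (intro sum.cong) auto
  then show ?thesis
    using assms by (simp add: diag_powr_def scalar_prod_def atLeast0LessThan)
qed

lemma diag_powr_mult_vec_index:
  assumes "M \<in> carrier_mat n n" "v \<in> carrier_vec n" "i < n"
  shows "(diag_powr M s *\<^sub>v v) $ i = M $$ (i, i) powr s * v $ i"
  using assms by (simp add: diag_powr_def scalar_prod_def sum_delta_mult_left atLeast0LessThan)

lemma mult_mat_vec_index:
  assumes "A \<in> carrier_mat n n" "v \<in> carrier_vec n" "i < n"
  shows "(A *\<^sub>v v) $ i = (\<Sum>j<n. A $$ (i, j) * v $ j)"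
  using assms by (simp add: scalar_prod_def atLeast0LessThan)

section \<open>The lazy matrix and its invariant subspace\<close>

definition lazy :: "real mat \<Rightarrow> real mat" where
  "lazy B = (1/2) \<cdot>\<^sub>m (1\<^sub>m (dim_row B) + B)"

lemma lazy_carrier [simp]: "B \<in> carrier_mat n n \<Longrightarrow> lazy B \<in> carrier_mat n n"
  by (auto simp: lazy_def)

lemma lazy_mult_vec:
  assumes "B \<in> carrier_mat n n" and "v \<in> carrier_vec n"
  shows "lazy B *\<^sub>v v = (1/2) \<cdot>\<^sub>v (v + B *\<^sub>v v)"
proof -
  have "lazy B *\<^sub>v v = (1/2) \<cdot>\<^sub>v ((1\<^sub>m n + B) *\<^sub>v v)"
    using assms by (intro eq_vecI) (auto simp: lazy_def)
  then show ?thesis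
    using assms by (simp add: add_mult_distrib_mat_vec[of _ n n])
qed

lemma mat_range_one_minus_carrier:
  "B \<in> carrier_mat n n \<Longrightarrow> mat_range (1\<^sub>m n - B) \<subseteq> carrier_vec n"
  by (auto simp: mat_range_def intro!: mult_mat_vec_carrier[of _ n n] minus_carrier_mat)

lemma one_minus_mult_vec:
  fixes B :: "real mat"
  assumes "B \<in> carrier_mat n n" and "v \<in> carrier_vec n"
  shows "(1\<^sub>m n - B) *\<^sub>v v = v - B *\<^sub>v v"
  using assms by (simp add: minus_mult_distrib_mat_vec[of _ n n])

text \<open>\<open>lazy B\<close> is a polynomial in \<open>B\<close>, hence commutes with I - B and
  preserves its range.\<close>

lemma lazy_mult_mat_range:
  assumes B: "B \<in> carrier_mat n n" and v: "v \<in> mat_range (1\<^sub>m n - B)"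
  shows "lazy B *\<^sub>v v \<in> mat_range (1\<^sub>m n - B)"
proof -
  obtain u where u: "u \<in> carrier_vec n" "v = u - B *\<^sub>v u"
    using v B by (auto simp: mat_range_def one_minus_mult_vec)
  have Bu: "B *\<^sub>v u \<in> carrier_vec n" "B *\<^sub>v (B *\<^sub>v u) \<in> carrier_vec n"
    using B u by auto
  have "lazy B *\<^sub>v v = (1/2) \<cdot>\<^sub>v ((u - B *\<^sub>v u) + (B *\<^sub>v u - B *\<^sub>v (B *\<^sub>v u)))"
    unfolding u(2) using B u(1) Bu
    by (subst lazy_mult_vec[of _ n]) (auto simp: mult_minus_distrib_mat_vec[of _ n n])
  also have "\<dots> = (1/2) \<cdot>\<^sub>v (u + B *\<^sub>v u) - (1/2) \<cdot>\<^sub>v (B *\<^sub>v u + B *\<^sub>v (B *\<^sub>v u))"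
    using u Bu by (intro eq_vecI) (auto simp: field_simps)
  also have "\<dots> = (1\<^sub>m n - B) *\<^sub>v ((1/2) \<cdot>\<^sub>v (u + B *\<^sub>v u))"
    using B u Bu
    by (simp add: one_minus_mult_vec mult_mat_vec[of _ n n] mult_add_distrib_mat_vec[of _ n n] del: smult_add_distrib_vec)
  finally show ?thesis
    using B u Bu by (auto simp: mat_range_def intro!: image_eqI)
qed

text \<open>Matrix powers grow by multiplication on the right, whereas the recursion along the walk
  applies the matrix on the left.\<close>

lemma pow_mat_Suc_left:
  fixes A :: "'a :: semiring_1 mat"
  assumes "A \<in> carrier_mat n n"
  shows "A ^\<^sub>m Suc k = A * A ^\<^sub>m k"
proof (induction k)
  case 0
  then show ?case using assms by simp
next
  case (Suc k)
  have "A ^\<^sub>m Suc (Suc k) = (A * A ^\<^sub>m k) * A"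
    using Suc by simp
  also have "\<dots> = A * (A ^\<^sub>m k * A)"
    using assms by (intro assoc_mult_mat) auto
  finally show ?case by simp
qed

lemma pow_mat_Suc_mult_vec:
  fixes A :: "'a :: comm_semiring_1 mat"
  assumes "A \<in> carrier_mat n n" and "v \<in> carrier_vec n"
  shows "A ^\<^sub>m Suc k *\<^sub>v v = A *\<^sub>v (A ^\<^sub>m k *\<^sub>v v)"
  unfolding pow_mat_Suc_left[OF assms(1)] using assms by (intro assoc_mult_mat_vec) auto

section \<open>Decay of the powers at the rate given by \<open>gamma_max\<close>\<close>

declare index_mult_mat_vec [simp del]

text \<open>The set of rates is nonempty because 1 and \<infinity> are conjugate, and bounded above
  by 1 because norms are nonnegative. So every number below its supremum is exceeded by the rate of
  some conjugate pair.\<close>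

lemma gamma_max_approx:
  assumes M: "M \<in> carrier_mat n n" and "g < gamma_max M"
  obtains p q where "1 \<le> p" "1 \<le> q" "1 / p + 1 / q = (1 :: ereal)"
    "restricted_norm p (lazy (scaled_AT M p q)) (mat_range (1\<^sub>m n - scaled_AT M p q)) < 1 - g"
proof -
  define G where "G = {1 - restricted_norm p ((1/2) \<cdot>\<^sub>m (1\<^sub>m (dim_row M) + scaled_AT M p q))
                (mat_range (1\<^sub>m (dim_row M) - scaled_AT M p q))
          | p q. 1 \<le> p \<and> 1 \<le> q \<and> 1 / p + 1 / q = (1 :: ereal)}"
  have car: "scaled_AT M p q \<in> carrier_mat n n" for p q
    using M by (auto simp: scaled_AT_def intro!: mult_carrier_mat)
  then have dim: "dim_row (scaled_AT M p q) = dim_row M" for p q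
    using M by (metis carrier_matD(1))
  have lazy: "(1/2) \<cdot>\<^sub>m (1\<^sub>m (dim_row M) + scaled_AT M p q) = lazy (scaled_AT M p q)" for p q
    by (simp add: lazy_def dim)
  have "(1::ereal) \<le> 1 \<and> (1::ereal) \<le> \<infinity> \<and> 1 / 1 + 1 / \<infinity> = (1::ereal)"
    by (simp add: one_ereal_def zero_ereal_def)
  then have "G \<noteq> {}"
    unfolding G_def by blast
  moreover have "bdd_above G"
    using M car
    by (intro bdd_aboveI[of _ 1])
      (auto simp: G_def lazy intro!: restricted_norm_nonneg[of _ n] mat_range_one_minus_carrier)
  moreover have "g < Sup G"
    using assms(2) by (simp add: gamma_max_def G_def)
  ultimately obtain a where "a \<in> G" "g < a"
    using less_cSup_iff by blast
  then show ?thesis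
    using that M by (force simp: G_def lazy)
qed

lemma Holder_conjugate_inverses:
  assumes "1 \<le> p" and "1 \<le> q" and "1 / p + 1 / q = (1 :: ereal)"
  shows "0 \<le> real_of_ereal (1 / p)" and "0 \<le> real_of_ereal (1 / q)"
    and "real_of_ereal (1 / p) + real_of_ereal (1 / q) = 1"
proof -
  show "0 \<le> real_of_ereal (1 / p)"
    using assms(1) by (cases rule: ereal_ge_1_cases) (auto simp: one_ereal_def)
  show "0 \<le> real_of_ereal (1 / q)"
    using assms(2) by (cases rule: ereal_ge_1_cases) (auto simp: one_ereal_def)
  have fin: "\<bar>1 / r\<bar> \<noteq> \<infinity>" if "1 \<le> r" for r :: ereal
    using that by (cases rule: ereal_ge_1_cases) (auto simp: one_ereal_def)
  have "real_of_ereal (1 / p + 1 / q) = real_of_ereal (1 / p) + real_of_ereal (1 / q)"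
    using fin[OF assms(1)] fin[OF assms(2)] by (subst real_of_ereal_add) auto
  then show "real_of_ereal (1 / p) + real_of_ereal (1 / q) = 1"
    using assms(3) by simp
qed

text \<open>As P = 1 - Q, conjugating D^(-1) A^T by D^P gives \<open>B\<close> = D^(-Q) A^T D^(-P).
  Hence D^P times the powers applied to D^(-1) b are iterates of \<open>lazy B\<close> with starting
  vector D^(-Q) b. Each entry is at most the p-norm, and the p-norm of the starting vector is at
  most its 1-norm.\<close>

lemma lazy_powers_decay:
  fixes M :: "real mat" and b :: "real vec" and p q :: ereal
  defines "B \<equiv> scaled_AT M p q" and "P \<equiv> real_of_ereal (1 / p)" and "Q \<equiv> real_of_ereal (1 / q)"
  assumes M: "M \<in> carrier_mat n n" and d: "\<And>i. i < n \<Longrightarrow> 0 < M $$ (i, i)"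
    and b: "b \<in> mat_range M" and pq: "1 \<le> p" "1 \<le> q" "1 / p + 1 / q = (1 :: ereal)"
    and i: "i < n"
  shows "M $$ (i, i) powr P * \<bar>(lazy (diag_inv M * AT M) ^\<^sub>m l *\<^sub>v (diag_inv M *\<^sub>v b)) $ i\<bar>
    \<le> restricted_norm p (lazy B) (mat_range (1\<^sub>m n - B)) ^ l
      * (\<Sum>j<n. M $$ (j, j) powr (- Q) * \<bar>b $ j\<bar>)"
proof -
  have PQ: "P = 1 - Q"
    using Holder_conjugate_inverses(3)[OF pq] by (simp add: P_def Q_def)
  define W where "W = lazy (diag_inv M * AT M)"
  have DA: "diag_inv M * AT M \<in> carrier_mat n n"
    using M by (auto intro!: mult_carrier_mat)
  then have W: "W \<in> carrier_mat n n"
    by (simp add: W_def)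
  have B: "B \<in> carrier_mat n n"
    using M by (auto simp: B_def scaled_AT_def intro!: mult_carrier_mat)
  obtain x where x: "x \<in> carrier_vec n" "b = M *\<^sub>v x"
    using b M by (auto simp: mat_range_def)
  have bc: "b \<in> carrier_vec n"
    using x M by auto
  have Db: "diag_inv M *\<^sub>v b \<in> carrier_vec n"
    by (rule mult_mat_vec_carrier[OF diag_powr_carrier[OF M] bc])
  define z where "z k = W ^\<^sub>m k *\<^sub>v (diag_inv M *\<^sub>v b)" for k
  have zc: "z k \<in> carrier_vec n" for k
    using W M bc by (auto simp: z_def intro!: mult_mat_vec_carrier[of _ n n] pow_carrier_mat)
  have z0: "z 0 = diag_inv M *\<^sub>v b"
    using W Db by (simp add: z_def)
  have zS: "z (Suc k) = W *\<^sub>v z k" for k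
    unfolding z_def by (rule pow_mat_Suc_mult_vec[OF W Db])
  define v where "v k = diag_powr M P *\<^sub>v z k" for k
  have vc: "v k \<in> carrier_vec n" for k
    using M zc by (auto simp: v_def intro!: mult_mat_vec_carrier[of _ n n])
  have v_index: "v k $ j = M $$ (j, j) powr P * z k $ j" if "j < n" for k j
    unfolding v_def using M zc that by (rule diag_powr_mult_vec_index)
  have B_index: "B $$ (j, k) = M $$ (j, j) powr (- Q) * AT M $$ (j, k) * M $$ (k, k) powr (- P)"
    if "j < n" "k < n" for j k
    unfolding B_def scaled_AT_def P_def Q_def
    using M that mult_carrier_mat[OF diag_powr_carrier[OF M] AT_carrier[OF M]]
    by (subst mult_diag_powr_index[of _ n]) (auto simp: diag_powr_mult_index[of _ n])
  have B_mult: "(B *\<^sub>v (diag_powr M P *\<^sub>v u)) $ j = M $$ (j, j) powr (- Q) * (AT M *\<^sub>v u) $ j"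
    if "u \<in> carrier_vec n" "j < n" for u j
  proof -
    have "(B *\<^sub>v (diag_powr M P *\<^sub>v u)) $ j = (\<Sum>k<n. B $$ (j, k) * (diag_powr M P *\<^sub>v u) $ k)"
      using that
      by (intro mult_mat_vec_index[OF B] mult_mat_vec_carrier[OF diag_powr_carrier[OF M]])
    also have "\<dots> = (\<Sum>k<n. M $$ (j, j) powr (- Q) * (AT M $$ (j, k) * u $ k))"
    proof (intro sum.cong refl)
      fix k assume "k \<in> {..<n}"
      then have k: "k < n" by simp
      then have "M $$ (k, k) powr (- P) * M $$ (k, k) powr P = 1"
        using d[OF k] by (simp flip: powr_add)
      then show "B $$ (j, k) * (diag_powr M P *\<^sub>v u) $ k
          = M $$ (j, j) powr (- Q) * (AT M $$ (j, k) * u $ k)"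
        using that k M by (simp add: B_index diag_powr_mult_vec_index[of _ n] flip: mult.assoc)
    qed
    also have "\<dots> = M $$ (j, j) powr (- Q) * (AT M *\<^sub>v u) $ j"
      using M that by (simp only: mult_mat_vec_index[of _ n] AT_carrier sum_distrib_left)
    finally show ?thesis .
  qed
  have vS: "v (Suc k) = lazy B *\<^sub>v v k" for k
  proof (rule eq_vecI)
    fix j assume "j < dim_vec (lazy B *\<^sub>v v k)"
    then have j: "j < n" using lazy_carrier[OF B] by simp
    have "(lazy B *\<^sub>v v k) $ j = 1/2 * (v k $ j + (B *\<^sub>v v k) $ j)"
      using B vc j by (subst lazy_mult_vec[OF B vc]) auto
    also have "\<dots> = 1/2 * (M $$ (j, j) powr P * z k $ j
        + M $$ (j, j) powr (- Q) * (AT M *\<^sub>v z k) $ j)"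
      using j zc by (simp add: v_index) (simp add: v_def B_mult)
    also have "M $$ (j, j) powr (- Q) = M $$ (j, j) powr P * M $$ (j, j) powr (- 1)"
      using d[OF j] by (simp add: PQ powr_diff powr_minus field_simps)
    also have "1/2 * (M $$ (j, j) powr P * z k $ j
        + M $$ (j, j) powr P * M $$ (j, j) powr (- 1) * (AT M *\<^sub>v z k) $ j)
        = M $$ (j, j) powr P * (1/2 * (z k $ j + M $$ (j, j) powr (- 1) * (AT M *\<^sub>v z k) $ j))"
      by (simp add: algebra_simps)
    also have "1/2 * (z k $ j + M $$ (j, j) powr (- 1) * (AT M *\<^sub>v z k) $ j) = (W *\<^sub>v z k) $ j"
    proof -
      have "W *\<^sub>v z k = (1/2) \<cdot>\<^sub>v (z k + diag_inv M *\<^sub>v (AT M *\<^sub>v z k))"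
        unfolding W_def using M DA zc
        by (simp add: lazy_mult_vec[OF DA zc] assoc_mult_mat_vec[of _ n n _ n])
      then show ?thesis
        using M zc[of k] j
          diag_powr_mult_vec_index[OF M mult_mat_vec_carrier[OF AT_carrier[OF M] zc] j, of "- 1" k]
        by simp
    qed
    finally show "v (Suc k) $ j = (lazy B *\<^sub>v v k) $ j"
      using j by (simp add: v_index zS)
  qed (use B vc M in \<open>simp add: lazy_def v_def\<close>)
  have v0: "v 0 $ j = M $$ (j, j) powr (- Q) * b $ j" if "j < n" for j
    using that M bc d[OF that]
    by (simp add: v_index z0 diag_powr_mult_vec_index[of _ n] PQ powr_diff powr_minus field_simps)
  \<comment> \<open>Here the range condition on \<open>b\<close> enters: for b = M x, D^(-Q) b =
    D^(-Q) (D - A^T) x = (I - B) D^P x, so the restricted norm applies to the starting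
    vector.\<close>
  have "v 0 = (1\<^sub>m n - B) *\<^sub>v (diag_powr M P *\<^sub>v x)"
  proof (rule eq_vecI)
    fix j assume "j < dim_vec ((1\<^sub>m n - B) *\<^sub>v (diag_powr M P *\<^sub>v x))"
    then have j: "j < n" using B by simp
    have Dx: "diag_powr M P *\<^sub>v x \<in> carrier_vec n"
      by (rule mult_mat_vec_carrier[OF diag_powr_carrier[OF M] x(1)])
    have "(AT M *\<^sub>v x) $ j = M $$ (j, j) * x $ j - b $ j"
    proof -
      have "AT M *\<^sub>v x = diag_part M *\<^sub>v x - M *\<^sub>v x"
        unfolding AT_def using M x
        by (intro minus_mult_distrib_mat_vec) (auto simp: diag_part_def)
      moreover have "(diag_part M *\<^sub>v x) $ j = M $$ (j, j) * x $ j"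
        using M x j
        by (simp add: index_mult_mat_vec diag_part_def scalar_prod_def sum_delta_mult_left atLeast0LessThan)
      ultimately show ?thesis
        using x M j by simp
    qed
    then have "((1\<^sub>m n - B) *\<^sub>v (diag_powr M P *\<^sub>v x)) $ j
      = M $$ (j, j) powr P * x $ j - M $$ (j, j) powr (- Q) * (M $$ (j, j) * x $ j - b $ j)"
      using B Dx x j M
      by (simp add: one_minus_mult_vec[OF B Dx] B_mult diag_powr_mult_vec_index[of _ n])
    moreover have "M $$ (j, j) powr (- Q) * M $$ (j, j) = M $$ (j, j) powr P"
      using d[OF j] by (simp add: PQ powr_mult_base mult.commute)
    ultimately show "v 0 $ j = ((1\<^sub>m n - B) *\<^sub>v (diag_powr M P *\<^sub>v x)) $ j"
      using j by (simp add: v0 right_diff_distrib flip: mult.assoc)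
  qed (use B M in \<open>simp add: v_def\<close>)
  then have v0_range: "v 0 \<in> mat_range (1\<^sub>m n - B)"
    using M x B by (auto simp: mat_range_def intro!: image_eqI mult_mat_vec_carrier[of _ n n])
  have n: "0 < n" using i by simp
  have "M $$ (i, i) powr P * \<bar>z l $ i\<bar> = \<bar>v l $ i\<bar>"
    using i by (simp add: v_index abs_mult)
  also have "\<dots> \<le> p_norm p (v l)"
    using abs_le_p_norm[OF pq(1), of i "v l"] i vc[of l] by simp
  also have "\<dots> \<le> restricted_norm p (lazy B) (mat_range (1\<^sub>m n - B)) ^ l * p_norm p (v 0)"
    using B n pq v0_range vS
    by (intro restricted_norm_power[of _ n] mat_range_one_minus_carrier lazy_mult_mat_range
        lazy_carrier) auto
  also have "\<dots> \<le> restricted_norm p (lazy B) (mat_range (1\<^sub>m n - B)) ^ l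
      * (\<Sum>j<n. \<bar>v 0 $ j\<bar>)"
    using p_norm_le_sum[OF pq(1), of "v 0"] vc[of 0] n B pq
    by (intro mult_left_mono zero_le_power restricted_norm_nonneg[of _ n]
        mat_range_one_minus_carrier lazy_carrier) auto
  also have "(\<Sum>j<n. \<bar>v 0 $ j\<bar>) = (\<Sum>j<n. M $$ (j, j) powr (- Q) * \<bar>b $ j\<bar>)"
    by (intro sum.cong) (auto simp: v0 abs_mult)
  finally show ?thesis
    by (simp add: z_def W_def)
qed

section \<open>The truncated series of a row diagonally dominant system\<close>

locale rddz_system =
  fixes n :: nat and M :: "real mat" and b t :: "real vec" and \<gamma> :: real
  assumes M: "M \<in> carrier_mat n n" and RDDZ: "RDDZ M"
    and b_range: "b \<in> mat_range M" and b_nonzero: "b \<noteq> 0\<^sub>v n" and b_nonneg: "\<And>i. i < n \<Longrightarrow> 0 \<le> b $ i"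
    and t: "t \<in> carrier_vec n" and t_nonzero: "t \<noteq> 0\<^sub>v n" and t_nonneg: "\<And>i. i < n \<Longrightarrow> 0 \<le> t $ i"
    and \<gamma>_pos: "0 < \<gamma>" and \<gamma>_le: "\<gamma> \<le> gamma_max M"
begin

definition reward :: "nat \<Rightarrow> real" where
  "reward v = (if v < n then b $ v / M $$ (v, v) else 0)"

text \<open>The expected reward at step \<open>l\<close> of a walk from \<open>i\<close>, and the
  \<open>l\<close>-th term of the series for \<open>2 * x_star M b $ i\<close>.\<close>

definition z :: "nat \<Rightarrow> nat \<Rightarrow> real" where
  "z l i = (walk_mat M ^\<^sub>m l *\<^sub>v (diag_inv M *\<^sub>v b)) $ i"

lemma b: "b \<in> carrier_vec n"
  using b_range M by (auto simp: mat_range_def)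

lemma n_pos: "0 < n"
  using t t_nonzero by (cases n) auto

section \<open>Consequences of diagonal dominance for the walk matrix\<close>

lemma diag_pos: "i < n \<Longrightarrow> 0 < M $$ (i, i)"
  using RDDZ M by (auto simp: RDDZ_def)

lemma offdiag_nonpos: "i < n \<Longrightarrow> j < n \<Longrightarrow> i \<noteq> j \<Longrightarrow> M $$ (i, j) \<le> 0"
  using RDDZ M by (auto simp: RDDZ_def)

lemma diag_dominant: "i < n \<Longrightarrow> (\<Sum>k\<in>{..<n} - {i}. \<bar>M $$ (i, k)\<bar>) \<le> M $$ (i, i)"
  using RDDZ M by (auto simp: RDDZ_def)

lemma reward_nonneg: "0 \<le> reward v"
  using b_nonneg diag_pos by (auto simp: reward_def less_imp_le)

lemma diag_inv_mult_index:
  assumes "v \<in> carrier_vec n" "i < n"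
  shows "(diag_inv M *\<^sub>v v) $ i = v $ i / M $$ (i, i)"
  using diag_powr_mult_vec_index[OF M assms, of "- 1"] diag_pos[OF assms(2)]
  by (simp add: powr_minus divide_inverse mult.commute)

lemma diag_inv_mult_carrier: "v \<in> carrier_vec n \<Longrightarrow> diag_inv M *\<^sub>v v \<in> carrier_vec n"
  using M by (auto intro!: mult_mat_vec_carrier[of _ n n])

lemma diag_inv_mult_nonzero:
  assumes v: "v \<in> carrier_vec n" "v \<noteq> 0\<^sub>v n"
  shows "diag_inv M *\<^sub>v v \<noteq> 0\<^sub>v (dim_vec (diag_inv M *\<^sub>v v))"
proof -
  obtain i where "i < n" "v $ i \<noteq> 0"
    using v by (auto simp: vec_eq_iff)
  then have "(diag_inv M *\<^sub>v v) $ i \<noteq> 0"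
    using diag_pos[of i] by (simp add: diag_inv_mult_index[OF v(1)])
  then show ?thesis
    using \<open>i < n\<close> M by (auto simp: vec_eq_iff)
qed

text \<open>Off-diagonal entries of \<open>M\<close> are nonpositive, so \<open>AT M\<close> is
  entrywise nonnegative and the absolute values change nothing. The matrix of the walk is therefore
  the one in the series for \<open>x_star\<close>.\<close>

lemma walk_mat_eq_lazy: "walk_mat M = lazy (diag_inv M * AT M)"
proof -
  have "map_mat abs (AT M) = AT M"
    using M by (intro eq_matI) (auto simp: AT_index[OF M] offdiag_nonpos AT_carrier[OF M, unfolded carrier_mat_def, simplified])
  then show ?thesis
    using M by (simp add: walk_mat_def lazy_def)
qed

lemma walk_mat_carrier: "walk_mat M \<in> carrier_mat n n"
  using M by (auto simp: walk_mat_eq_lazy intro!: lazy_carrier mult_carrier_mat)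

lemma walk_mat_index:
  assumes "i < n" "j < n"
  shows "walk_mat M $$ (i, j) = (if i = j then 1/2 else \<bar>M $$ (i, j)\<bar> / (2 * M $$ (i, i)))"
proof -
  have "walk_mat M $$ (i, j)
      = 1/2 * ((if i = j then 1 else 0) + M $$ (i, i) powr (- 1) * AT M $$ (i, j))"
    using M AT_carrier[OF M] assms
    by (simp add: walk_mat_eq_lazy lazy_def diag_powr_mult_index[of _ n] del: AT_carrier index_mult_mat(1))
  then show ?thesis
    using assms diag_pos[OF assms(1)] offdiag_nonpos[OF assms]
    by (auto simp: AT_index[OF M] powr_minus field_simps)
qed

lemma walk_mat_nonneg: "i < n \<Longrightarrow> j < n \<Longrightarrow> 0 \<le> walk_mat M $$ (i, j)"
  using diag_pos by (simp add: walk_mat_index less_imp_le)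

lemma walk_mat_row_sum:
  assumes "i < n"
  shows "(\<Sum>k<n. walk_mat M $$ (i, k)) \<le> 1"
proof -
  have "(\<Sum>k<n. walk_mat M $$ (i, k)) = 1/2 + (\<Sum>k\<in>{..<n} - {i}. \<bar>M $$ (i, k)\<bar> / (2 * M $$ (i, i)))"
    using assms by (subst sum.remove[of _ i]) (auto simp: walk_mat_index intro!: sum.cong)
  also have "\<dots> = 1/2 + (\<Sum>k\<in>{..<n} - {i}. \<bar>M $$ (i, k)\<bar>) / (2 * M $$ (i, i))"
    by (simp add: sum_divide_distrib)
  also have "\<dots> \<le> 1"
    using diag_dominant[OF assms] diag_pos[OF assms] by (simp add: field_simps)
  finally show ?thesis .
qed

lemma z_0: "i < n \<Longrightarrow> z 0 i = reward i"
  using b walk_mat_carrier diag_inv_mult_carrier[OF b]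
  by (simp add: z_def reward_def diag_inv_mult_index del: index_mult_mat_vec)

lemma z_Suc:
  assumes "i < n"
  shows "z (Suc l) i = (\<Sum>k<n. walk_mat M $$ (i, k) * z l k)"
proof -
  have "z (Suc l) i = (walk_mat M *\<^sub>v (walk_mat M ^\<^sub>m l *\<^sub>v (diag_inv M *\<^sub>v b))) $ i"
    unfolding z_def
    by (subst pow_mat_Suc_mult_vec[OF walk_mat_carrier diag_inv_mult_carrier[OF b]]) simp
  also have "\<dots> = (\<Sum>k<n. walk_mat M $$ (i, k) * z l k)"
    unfolding z_def
    by (rule mult_mat_vec_index[OF walk_mat_carrier mult_mat_vec_carrier[OF
          pow_carrier_mat[OF walk_mat_carrier] diag_inv_mult_carrier[OF b]] assms])
  finally show ?thesis .
qed

lemma z_nonneg: "i < n \<Longrightarrow> 0 \<le> z l i"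
proof (induction l arbitrary: i)
  case 0
  then show ?case by (simp add: z_0 reward_nonneg)
next
  case (Suc l)
  then show ?case by (auto simp: z_Suc intro!: sum_nonneg mult_nonneg_nonneg walk_mat_nonneg)
qed

text \<open>The mass missing from row \<open>j\<close> goes to the termination vertex
  \<open>n\<close>; \<open>walk_mat_row_sum\<close> makes it nonnegative. A function vanishing at
  \<open>n\<close> does not see it, so its expectation is a plain matrix row product.\<close>

lemma finite_set_walk_step: "finite (set_pmf (walk_step M j))"
  and expectation_walk_step: "h n = 0 \<Longrightarrow> measure_pmf.expectation (walk_step M j) h
    = (if j < n then (\<Sum>k<n. walk_mat M $$ (j, k) * h k) else 0)"
proof -
  let ?f = "\<lambda>k. if k < n then walk_mat M $$ (j, k)
    else if k = n then 1 - (\<Sum>k<n. walk_mat M $$ (j, k)) else 0"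
  have step: "walk_step M j = (if j < n then embed_pmf ?f else return_pmf n)"
    using M by (simp add: walk_step_def Let_def)
  have sum: "(\<Sum>k\<le>n. ?f k * h k)
      = (\<Sum>k<n. walk_mat M $$ (j, k) * h k) + (1 - (\<Sum>k<n. walk_mat M $$ (j, k))) * h n" for h
    by (simp flip: lessThan_Suc_atMost)
  have props: "finite {..n}" "\<And>x. 0 \<le> ?f x" "\<And>x. x \<notin> {..n} \<Longrightarrow> ?f x = 0" "sum ?f {..n} = 1" if "j < n"
    using that walk_mat_row_sum[OF that] sum[of "\<lambda>_. 1"] by (auto simp: walk_mat_nonneg)
  show "finite (set_pmf (walk_step M j))"
    using expectation_embed_pmf_finite(1)[of "{..n}" ?f, OF props] by (auto simp: step)
  show "measure_pmf.expectation (walk_step M j) h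
    = (if j < n then (\<Sum>k<n. walk_mat M $$ (j, k) * h k) else 0)" if "h n = 0"
    using expectation_embed_pmf_finite(3)[of "{..n}" ?f h, OF props] that by (auto simp: step sum)
qed

lemma p_norm_1_t: "p_norm 1 t = (\<Sum>i<n. t $ i)"
  using t t_nonneg by (simp add: p_norm_1)

lemma p_norm_1_t_pos: "0 < p_norm 1 t"
  using t t_nonzero by (intro p_norm_pos) auto

lemma finite_set_vec_sample: "finite (set_pmf (vec_sample t))"
  and expectation_vec_sample: "measure_pmf.expectation (vec_sample t) h
    = (\<Sum>i<n. t $ i * h i) / p_norm 1 t"
proof -
  let ?f = "\<lambda>i. if i < n then t $ i / p_norm 1 t else 0"
  have sample: "vec_sample t = embed_pmf ?f"
    using t by (simp add: vec_sample_def)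
  have sum: "(\<Sum>i<n. ?f i * h i) = (\<Sum>i<n. t $ i * h i) / p_norm 1 t" for h
    by (simp add: sum_divide_distrib)
  have props: "finite {..<n}" "\<And>x. 0 \<le> ?f x" "\<And>x. x \<notin> {..<n} \<Longrightarrow> ?f x = 0" "sum ?f {..<n} = 1"
    using p_norm_1_t_pos sum[of "\<lambda>_. 1"] t_nonneg by (auto simp: p_norm_1_t)
  show "finite (set_pmf (vec_sample t))"
    using expectation_embed_pmf_finite(1)[of "{..<n}" ?f, OF props] by (simp add: sample)
  show "measure_pmf.expectation (vec_sample t) h = (\<Sum>i<n. t $ i * h i) / p_norm 1 t"
    unfolding sample sum[symmetric] by (rule expectation_embed_pmf_finite) (fact props)+
qed

text \<open>One step of the walk applies \<open>walk_mat M\<close> and thereby shifts the index of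
  \<open>z\<close>, while the reward of the starting vertex supplies the term \<open>z 0 v\<close>.
  The expected reward is thus a truncation of the series for twice the solution.\<close>

lemma walk_reward_eq:
  "walk_reward (walk_step M) reward m v = (if v < n then \<Sum>l<m. z l v else 0)"
proof (induction m arbitrary: v)
  case (Suc m)
  show ?case
  proof (cases "v < n")
    case True
    have "walk_reward (walk_step M) reward (Suc m) v
        = reward v + (\<Sum>k<n. walk_mat M $$ (v, k) * (\<Sum>l<m. z l k))"
      using True by (simp add: Suc expectation_walk_step)
    also have "(\<Sum>k<n. walk_mat M $$ (v, k) * (\<Sum>l<m. z l k)) = (\<Sum>l<m. z (Suc l) v)"
      unfolding sum_distrib_left using True by (subst sum.swap) (simp add: z_Suc)
    finally show ?thesis
      using True by (simp add: z_0 sum.lessThan_Suc_shift del: sum.lessThan_Suc)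
  next
    case False
    then show ?thesis
      by (simp add: Suc expectation_walk_step) (simp add: reward_def)
  qed
qed simp

section \<open>Geometric decay of the series\<close>

lemma d_max_ge: "i < n \<Longrightarrow> M $$ (i, i) \<le> d_max M"
  using M by (auto simp: d_max_def intro!: Max_ge)

lemma d_max_pos: "0 < d_max M"
  using d_max_ge[OF n_pos] diag_pos[OF n_pos] by linarith

text \<open>Writing M_ii^(-s) v_i as M_ii^(1-s) * (v_i / M_ii) leaves a nonnegative exponent, so
  \<open>d_max M\<close> can replace the diagonal entry. Only the nonzero entries of
  \<open>v\<close> are counted.\<close>

lemma sum_diag_powr_le:
  assumes v: "v \<in> carrier_vec n" "\<And>i. i < n \<Longrightarrow> 0 \<le> v $ i" and s: "s \<le> 1"
  shows "(\<Sum>i<n. M $$ (i, i) powr (- s) * v $ i)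
    \<le> d_max M powr (1 - s) * (real (norm0 v) * p_norm \<infinity> (diag_inv M *\<^sub>v v))"
proof -
  let ?N = "{i. i < n \<and> v $ i \<noteq> 0}"
  have "(\<Sum>i<n. M $$ (i, i) powr (- s) * v $ i) = (\<Sum>i\<in>?N. M $$ (i, i) powr (- s) * v $ i)"
    by (intro sum.mono_neutral_right) auto
  also have "\<dots> \<le> (\<Sum>i\<in>?N. d_max M powr (1 - s) * p_norm \<infinity> (diag_inv M *\<^sub>v v))"
  proof (intro sum_mono)
    fix i assume "i \<in> ?N"
    then have i: "i < n" by simp
    have "M $$ (i, i) powr (- s) * v $ i = M $$ (i, i) powr (1 - s) * (v $ i / M $$ (i, i))"
      using diag_pos[OF i] by (simp add: powr_diff powr_minus field_simps)
    also have "\<dots> = M $$ (i, i) powr (1 - s) * (diag_inv M *\<^sub>v v) $ i"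
      using i by (simp add: diag_inv_mult_index[OF v(1)])
    also have "\<dots> \<le> d_max M powr (1 - s) * p_norm \<infinity> (diag_inv M *\<^sub>v v)"
    proof (intro mult_mono powr_mono2)
      show "(diag_inv M *\<^sub>v v) $ i \<le> p_norm \<infinity> (diag_inv M *\<^sub>v v)"
        using abs_le_p_norm[of \<infinity> i "diag_inv M *\<^sub>v v"] i M by simp
      show "0 \<le> (diag_inv M *\<^sub>v v) $ i"
        unfolding diag_inv_mult_index[OF v(1) i] using v(2)[OF i] diag_pos[OF i] by simp
    qed (use s i d_max_ge diag_pos in \<open>auto simp: less_imp_le\<close>)
    finally show "M $$ (i, i) powr (- s) * v $ i \<le> d_max M powr (1 - s) * p_norm \<infinity> (diag_inv M *\<^sub>v v)" .
  qed
  finally show ?thesis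
    using v(1) by (simp add: norm0_def algebra_simps)
qed

definition H :: real where
  "H = d_max M * real (norm0 t) * p_norm \<infinity> (diag_inv M *\<^sub>v t)
    * real (norm0 b) * p_norm \<infinity> (diag_inv M *\<^sub>v b)"

lemma log_arg_eq: "log_arg M b t \<gamma> E = H / (\<gamma> * E)"
  by (simp add: log_arg_def H_def)

lemma H_pos: "0 < H"
  unfolding H_def
  using norm0_pos[of t] norm0_pos[of b] t b t_nonzero b_nonzero d_max_pos
    p_norm_pos[OF _ diag_inv_mult_nonzero[OF t t_nonzero], of \<infinity>]
    p_norm_pos[OF _ diag_inv_mult_nonzero[OF b b_nonzero], of \<infinity>]
  by (intro mult_pos_pos) auto

text \<open>The constant 2/3 only has to be less than 1, so that the supremum in \<open>gamma_max\<close> need not be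
  attained.\<close>

lemma geometric_decay:
  obtains \<rho> where "0 \<le> \<rho>" "\<rho> < 1 - 2/3 * \<gamma>" "\<And>i. i < n \<Longrightarrow> \<exists>C. \<forall>l. z l i \<le> C * \<rho> ^ l"
    "\<And>l. (\<Sum>i<n. t $ i * z l i) \<le> H * \<rho> ^ l"
proof -
  have "2/3 * \<gamma> < gamma_max M"
    using \<gamma>_pos \<gamma>_le by linarith
  then obtain p q where pq: "1 \<le> p" "1 \<le> q" "1 / p + 1 / q = (1 :: ereal)"
    and "restricted_norm p (lazy (scaled_AT M p q)) (mat_range (1\<^sub>m n - scaled_AT M p q)) < 1 - 2/3 * \<gamma>"
    using gamma_max_approx[OF M] by metis
  moreover define \<rho> where
    "\<rho> = restricted_norm p (lazy (scaled_AT M p q)) (mat_range (1\<^sub>m n - scaled_AT M p q))"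
  ultimately have \<rho>: "\<rho> < 1 - 2/3 * \<gamma>"
    by simp
  have B: "scaled_AT M p q \<in> carrier_mat n n"
    using M by (auto simp: scaled_AT_def intro!: mult_carrier_mat)
  have \<rho>0: "0 \<le> \<rho>"
    unfolding \<rho>_def using B pq
    by (intro restricted_norm_nonneg[of _ n] mat_range_one_minus_carrier lazy_carrier)
  define P Q where "P = real_of_ereal (1 / p)" and "Q = real_of_ereal (1 / q)"
  have PQ: "0 \<le> P" "0 \<le> Q" "P + Q = 1"
    using Holder_conjugate_inverses[OF pq] by (auto simp: P_def Q_def)
  define T where "T = (\<Sum>j<n. M $$ (j, j) powr (- Q) * b $ j)"
  have z_le: "z l i \<le> M $$ (i, i) powr (- P) * T * \<rho> ^ l" if i: "i < n" for i l
  proof -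
    have "M $$ (i, i) powr P * z l i \<le> \<rho> ^ l * (\<Sum>j<n. M $$ (j, j) powr (- Q) * \<bar>b $ j\<bar>)"
      using lazy_powers_decay[OF M diag_pos b_range pq i, of l] z_nonneg[OF i, of l]
      unfolding P_def Q_def \<rho>_def z_def walk_mat_eq_lazy by simp
    also have "\<dots> = \<rho> ^ l * T"
      by (auto simp: T_def b_nonneg)
    finally show ?thesis
      using diag_pos[OF i] by (simp add: powr_minus field_simps)
  qed
  have T: "0 \<le> T" "T \<le> d_max M powr P * (real (norm0 b) * p_norm \<infinity> (diag_inv M *\<^sub>v b))"
    using sum_diag_powr_le[OF b b_nonneg, of Q] PQ
    by (auto simp: T_def eq_diff_eq[symmetric] b_nonneg intro!: sum_nonneg)
  have "(\<Sum>i<n. t $ i * z l i) \<le> H * \<rho> ^ l" for l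
  proof -
    have "(\<Sum>i<n. t $ i * z l i) \<le> (\<Sum>i<n. t $ i * (M $$ (i, i) powr (- P) * T * \<rho> ^ l))"
      by (intro sum_mono mult_left_mono) (auto simp: z_le t_nonneg)
    also have "\<dots> = (\<Sum>i<n. M $$ (i, i) powr (- P) * t $ i) * T * \<rho> ^ l"
      by (simp add: sum_distrib_left sum_distrib_right algebra_simps)
    \<comment> \<open>\<open>t\<close> is weighted with exponent -P and contributes d_max^Q;
      \<open>b\<close> is weighted with exponent -Q and contributes d_max^P. Since P + Q = 1,
      \<open>H\<close> contains \<open>d_max M\<close> exactly once, whatever the pair of
      exponents.\<close>
    also have "\<dots> \<le> (d_max M powr Q * (real (norm0 t) * p_norm \<infinity> (diag_inv M *\<^sub>v t)))
        * (d_max M powr P * (real (norm0 b) * p_norm \<infinity> (diag_inv M *\<^sub>v b))) * \<rho> ^ l"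
    proof (intro mult_right_mono mult_mono T)
      show "(\<Sum>i<n. M $$ (i, i) powr (- P) * t $ i)
          \<le> d_max M powr Q * (real (norm0 t) * p_norm \<infinity> (diag_inv M *\<^sub>v t))"
        using sum_diag_powr_le[OF t t_nonneg, of P] PQ by (simp add: eq_diff_eq[symmetric])
    qed (use \<rho>0 t M n_pos in \<open>auto intro!: mult_nonneg_nonneg p_norm_nonneg\<close>)
    also have "\<dots> = (d_max M powr Q * d_max M powr P) * real (norm0 t)
        * p_norm \<infinity> (diag_inv M *\<^sub>v t) * real (norm0 b) * p_norm \<infinity> (diag_inv M *\<^sub>v b) * \<rho> ^ l"
      by (simp only: ac_simps)
    also have "d_max M powr Q * d_max M powr P = d_max M"
      using d_max_pos PQ by (simp add: add.commute flip: powr_add)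
    finally show ?thesis by (simp add: H_def)
  qed
  then show ?thesis
    using that \<rho> \<rho>0 z_le by blast
qed

text \<open>Summability is required at every vertex, also where \<open>t\<close> vanishes, which is
  why \<open>geometric_decay\<close> provides a separate bound for each entry.\<close>

lemma summable_z:
  assumes "i < n"
  shows "summable (\<lambda>l. z l i)"
proof -
  obtain \<rho> where "0 \<le> \<rho>" "\<rho> < 1 - 2/3 * \<gamma>" "\<exists>C. \<forall>l. z l i \<le> C * \<rho> ^ l"
    using geometric_decay assms by metis
  then obtain C where "0 \<le> \<rho>" "\<rho> < 1" "\<And>l. z l i \<le> C * \<rho> ^ l"
    using \<gamma>_pos by auto
  then show ?thesis
    using z_nonneg[OF assms]
    by (intro summable_comparison_test[OF _ summable_mult[OF summable_geometric[of \<rho>], of C]]) auto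
qed

lemma x_star_carrier: "x_star M b \<in> carrier_vec n"
  using M by (simp add: x_star_def Let_def)

lemma x_star_index:
  assumes "i < n"
  shows "x_star M b $ i = 1/2 * (\<Sum>l. z l i)"
proof -
  have "walk_mat M = (1/2) \<cdot>\<^sub>m (1\<^sub>m (dim_row M) + diag_inv M * AT M)"
    using M by (simp add: walk_mat_eq_lazy lazy_def)
  then show ?thesis
    using assms M unfolding x_star_def z_def Let_def by simp
qed

lemma sum_z_le:
  assumes "i < n"
  shows "(\<Sum>l<m. z l i) \<le> 2 * p_norm \<infinity> (x_star M b)"
proof -
  have "(\<Sum>l<m. z l i) \<le> (\<Sum>l. z l i)"
    using assms by (intro sum_le_suminf summable_z) (auto simp: z_nonneg)
  also have "\<dots> = 2 * x_star M b $ i"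
    using assms by (simp add: x_star_index)
  also have "\<dots> \<le> 2 * p_norm \<infinity> (x_star M b)"
    using abs_le_p_norm[of \<infinity> i "x_star M b"] x_star_carrier assms by simp
  finally show ?thesis .
qed

text \<open>All terms of the series are nonnegative, so its first term D^(-1) b is a lower bound for
  the sum. This shows that the solution is nonzero and later cancels the norm of D^(-1) b in the
  logarithm.\<close>

lemma p_norm_x_star_ge: "p_norm \<infinity> (diag_inv M *\<^sub>v b) \<le> 2 * p_norm \<infinity> (x_star M b)"
proof (rule p_norm_infinity_le)
  fix i assume "i < dim_vec (diag_inv M *\<^sub>v b)"
  then have i: "i < n"
    using M by simp
  then have "\<bar>(diag_inv M *\<^sub>v b) $ i\<bar> = reward i"
    using b_nonneg diag_pos[OF i] by (simp only: diag_inv_mult_index[OF b] reward_def) simp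
  then show "\<bar>(diag_inv M *\<^sub>v b) $ i\<bar> \<le> 2 * p_norm \<infinity> (x_star M b)"
    using sum_z_le[OF i, of 1] i by (simp add: z_0)
qed (use M n_pos in simp)

lemma p_norm_x_star_pos: "0 < p_norm \<infinity> (x_star M b)"
  using p_norm_x_star_ge p_norm_pos[of \<infinity>, OF _ diag_inv_mult_nonzero[OF b b_nonzero]] by simp

lemma walk_reward_le: "walk_reward (walk_step M) reward m v \<le> 2 * p_norm \<infinity> (x_star M b)"
  using sum_z_le p_norm_x_star_pos by (auto simp: walk_reward_eq)

lemma truncation_error:
  assumes E: "0 < E" and m: "ln (log_arg M b t \<gamma> E) \<le> 2/3 * \<gamma> * real m"
  shows "\<bar>1/2 * (\<Sum>i<n. t $ i * walk_reward (walk_step M) reward m i) - t \<bullet> x_star M b\<bar> \<le> 3/4 * E"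
proof -
  obtain \<rho> where \<rho>: "0 \<le> \<rho>" "\<rho> < 1 - 2/3 * \<gamma>" "\<And>l. (\<Sum>i<n. t $ i * z l i) \<le> H * \<rho> ^ l"
    using geometric_decay by metis
  define a where "a l = (\<Sum>i<n. t $ i * z l i)" for l
  have a0: "0 \<le> a l" for l
    by (auto simp: a_def t_nonneg z_nonneg intro!: sum_nonneg)
  have sum_a: "summable a"
    unfolding a_def by (intro summable_sum summable_mult summable_z) auto
  have "t \<bullet> x_star M b = 1/2 * (\<Sum>i<n. t $ i * (\<Sum>l. z l i))"
    using x_star_carrier by (simp add: scalar_prod_def x_star_index atLeast0LessThan sum_divide_distrib)
  also have "(\<Sum>i<n. t $ i * (\<Sum>l. z l i)) = (\<Sum>l. a l)"
    unfolding a_def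
    by (subst suminf_sum) (auto intro!: sum.cong summable_mult summable_z simp: suminf_mult summable_z)
  also have "\<dots> = (\<Sum>l. a (l + m)) + (\<Sum>l<m. a l)"
    by (rule suminf_split_initial_segment[OF sum_a])
  also have "(\<Sum>l<m. a l) = (\<Sum>i<n. t $ i * walk_reward (walk_step M) reward m i)"
    unfolding a_def by (subst sum.swap) (simp add: walk_reward_eq sum_distrib_left)
  finally have eq: "1/2 * (\<Sum>i<n. t $ i * walk_reward (walk_step M) reward m i) - t \<bullet> x_star M b
      = - (1/2 * (\<Sum>l. a (l + m)))"
    by (simp add: algebra_simps)
  have \<rho>1: "\<rho> < 1" using \<rho> \<gamma>_pos by linarith
  have tail0: "0 \<le> (\<Sum>l. a (l + m))"
    using sum_a a0 by (intro suminf_nonneg) (auto simp: summable_iff_shift)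
  have "(\<Sum>l. a (l + m)) \<le> (\<Sum>l. H * \<rho> ^ m * \<rho> ^ l)"
  proof (intro suminf_le)
    show "a (l + m) \<le> H * \<rho> ^ m * \<rho> ^ l" for l
      using \<rho>(3)[of "l + m"] by (simp add: a_def power_add algebra_simps)
  qed (use sum_a \<rho> \<rho>1 in \<open>auto simp: summable_iff_shift intro!: summable_mult summable_geometric\<close>)
  also have "\<dots> = H * \<rho> ^ m / (1 - \<rho>)"
    using \<rho> \<rho>1 by (simp add: suminf_mult suminf_geometric summable_geometric)
  \<comment> \<open>The rate is used twice: \<open>1 - \<rho>\<close> exceeds
    \<open>2/3 * \<gamma>\<close> in the denominator, and \<rho> <= 1 - 2/3 \<gamma> <= exp (- 2/3
    \<gamma>) in the power.\<close>
  also have "\<dots> \<le> H * exp (- ln (log_arg M b t \<gamma> E)) / (2/3 * \<gamma>)"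
  proof (intro frac_le mult_left_mono mult_nonneg_nonneg)
    have "\<rho> \<le> exp (- (2/3 * \<gamma>))"
      using \<rho>(2) exp_ge_add_one_self[of "- (2/3 * \<gamma>)"] by linarith
    then have "\<rho> ^ m \<le> exp (- (2/3 * \<gamma>)) ^ m"
      using \<rho>(1) by (rule power_mono)
    also have "\<dots> = exp (- (2/3 * \<gamma> * real m))"
      by (simp add: algebra_simps flip: exp_of_nat_mult)
    also have "\<dots> \<le> exp (- ln (log_arg M b t \<gamma> E))"
      using m by simp
    finally show "\<rho> ^ m \<le> exp (- ln (log_arg M b t \<gamma> E))" .
  qed (use H_pos \<gamma>_pos \<rho> in auto)
  also have "exp (- ln (log_arg M b t \<gamma> E)) = \<gamma> * E / H"
    using H_pos \<gamma>_pos E by (simp add: exp_minus log_arg_eq)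
  \<comment> \<open>The factor 1/2 in front of the series turns this into \<open>3/4 * E\<close>,
    leaving one quarter of \<open>E\<close> for the sampling error.\<close>
  also have "H * (\<gamma> * E / H) / (2/3 * \<gamma>) = 3/2 * E"
    using H_pos \<gamma>_pos by simp
  finally show ?thesis
    using tail0 unfolding eq by simp
qed

end

section \<open>The Monte Carlo program\<close>

text \<open>Natural cell 3 holds the vertex of the walk. The real cells hold: 3 the total reward, 4 the number
  of steps of the current walk, 5 the number of finished walks, 6 the constant 1, 7 the length of a
  walk, 8 the (not necessarily integral) number of walks to reach. The vertex \<open>n\<close> of a terminated walk
  needs no test, because both reads return 0 there and \<open>0 / 0 = 0\<close>.\<close>

definition step_prog :: prog where
  "step_prog = Seq (Do (ReadB 9 3)) (Seq (Do (ReadDiag 10 3)) (Seq (Do (RDiv 9 9 10))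
    (Seq (Do (RAdd 3 3 9)) (Seq (Do (WalkStep 3 3)) (Do (RAdd 4 4 6))))))"

definition sample_prog :: prog where
  "sample_prog = Seq (Do (SampleT 3)) (Seq (Do (RSub 4 4 4))
    (Seq (While (RLess 4 7) step_prog) (Do (RAdd 5 5 6))))"

definition init_prog :: "nat \<Rightarrow> prog" where
  "init_prog K = Seq (Do (NConst 2 1)) (Seq (Do (RofN 6 2)) (Seq (Do (NConst 2 K)) (Seq (Do (RofN 7 2))
    (Seq (Do (RofN 9 1)) (Seq (Do (RMul 7 7 9)) (Seq (Do (NConst 2 128)) (Seq (Do (RofN 8 2))
    (Seq (Do (RMul 8 8 2)) (Seq (Do (RMul 8 8 2)) (Seq (Do (RDiv 8 8 0)) (Do (RDiv 8 8 0))))))))))))"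

text \<open>Doubling the number of walks supplies the factor 1/2 of \<open>x_star\<close>;
  multiplying by \<open>p_norm 1 t\<close>, held in real cell 2, undoes the normalisation of the
  starting distribution.\<close>

definition final_prog :: prog where
  "final_prog = Seq (Do (RAdd 5 5 5)) (Seq (Do (RMul 0 2 3)) (Do (RDiv 0 0 5)))"

definition estimator :: "nat \<Rightarrow> prog" where
  "estimator K = If (RLess 0 2)
    (Seq (init_prog K) (Seq (While (RLess 5 8) sample_prog) final_prog))
    (Do (RSub 0 0 0))"

locale rddz_machine = rddz_system +
  fixes \<tau> :: "nat \<Rightarrow> nat"
  assumes \<tau>: "\<And>j. j < n \<Longrightarrow> 1 \<le> \<tau> j"
begin

abbreviation S :: lin_sys where
  "S \<equiv> \<lparr>mtx = M, rhs = b, tgt = t, step_time = \<tau>\<rparr>"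

abbreviation F :: nat where
  "F \<equiv> f_row S"

lemma \<tau>_le: "j < n \<Longrightarrow> \<tau> j \<le> F"
  using M by (auto simp: f_row_def intro!: Max_ge)

lemma F_pos: "1 \<le> F"
  using \<tau>[OF n_pos] \<tau>_le[OF n_pos] by linarith

text \<open>The 6 extra units of time are the five other instructions and the loop test preceding
  the step.\<close>

definition step_sem :: "state \<Rightarrow> state pmf" where
  "step_sem s = map_pmf (\<lambda>k. s\<lparr>nmem := (nmem s)(3 := k),
      rmem := (rmem s)(10 := (if nmem s 3 < n then M $$ (nmem s 3, nmem s 3) else 0),
        9 := reward (nmem s 3), 3 := rmem s 3 + reward (nmem s 3), 4 := rmem s 4 + rmem s 6),
      clock := clock s + (if nmem s 3 < n then \<tau> (nmem s 3) else 1) + 6\<rparr>)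
    (walk_step M (nmem s 3))"

lemma exec_step_prog: "exec S step_prog (tick 1 s) = spmf_of_pmf (step_sem s)"
  using M b
  by (simp add: step_prog_def step_sem_def nset_def rset_def tick_def reward_def bind_map_pmf
      map_pmf_comp bind_pmf_return_spmf o_def cong: if_cong) (simp add: eval_nat_numeral)

lemma finite_set_step_sem: "finite (set_pmf (step_sem s))"
  by (simp add: step_sem_def finite_set_walk_step)

lemma map_step_sem: "map_pmf (\<lambda>s. nmem s 3) (step_sem s) = walk_step M (nmem s 3)"
  by (simp add: step_sem_def map_pmf_comp)

lemma step_semD:
  assumes "s' \<in> set_pmf (step_sem s)"
  shows "rmem s' 3 = rmem s 3 + reward (nmem s 3)"
    and "rmem s' 4 = rmem s 4 + rmem s 6"
    and "r \<notin> {3, 4, 9, 10} \<Longrightarrow> rmem s' r = rmem s r"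
    and "clock s' \<le> clock s + 7 * F"
proof -
  have "(if nmem s 3 < n then \<tau> (nmem s 3) else 1) \<le> F"
    using \<tau>_le F_pos by auto
  then show "clock s' \<le> clock s + 7 * F"
    using assms F_pos by (auto simp: step_sem_def)
qed (use assms in \<open>auto simp: step_sem_def\<close>)

text \<open>\<open>j\<close> counts the steps still to take and \<open>c\<close> is a fixed budget:
  the time spent plus the worst cost of the remaining steps never exceeds it. The exempted real
  cells are the total reward, the step counter and two scratch cells.\<close>

definition walk_inv :: "state \<Rightarrow> nat \<Rightarrow> nat \<Rightarrow> nat \<Rightarrow> state \<Rightarrow> bool" where
  "walk_inv s\<^sub>0 c m j s \<longleftrightarrow> rmem s 6 = 1 \<and> rmem s 7 = real m \<and> rmem s 4 + real j = real m \<and>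
    clock s + j * (7 * F) \<le> c \<and> (\<forall>r. r \<notin> {3, 4, 9, 10} \<longrightarrow> rmem s r = rmem s\<^sub>0 r)"

lemma walk_inv_step:
  assumes "walk_inv s\<^sub>0 c m (Suc j) s" and "s' \<in> set_pmf (step_sem s)"
  shows "walk_inv s\<^sub>0 c m j s'"
  using assms(1) step_semD[OF assms(2)] by (auto simp: walk_inv_def)

text \<open>The 3 units of time include the test of the outer loop; the 2 units in
  \<open>sample_end\<close> include the last, failing test of the inner loop.\<close>

definition sample_start :: "state \<Rightarrow> nat \<Rightarrow> state" where
  "sample_start s k = s\<lparr>nmem := (nmem s)(3 := k), rmem := (rmem s)(4 := 0), clock := clock s + 3\<rparr>"

definition sample_end :: "state \<Rightarrow> state" where
  "sample_end s = s\<lparr>rmem := (rmem s)(5 := rmem s 5 + rmem s 6), clock := clock s + 2\<rparr>"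

definition sample_sem :: "nat \<Rightarrow> state \<Rightarrow> state pmf" where
  "sample_sem m s
    = bind_pmf (vec_sample t) (\<lambda>k. map_pmf sample_end (iter_pmf m step_sem (sample_start s k)))"

lemma walk_inv_sample_start:
  assumes "rmem s 6 = 1" "rmem s 7 = real m"
  shows "walk_inv s (clock s + 3 + m * (7 * F)) m m (sample_start s k)"
  using assms by (auto simp: walk_inv_def sample_start_def)

lemma exec_sample_prog:
  assumes s: "rmem s 6 = 1" "rmem s 7 = real m"
  shows "exec S sample_prog (tick 1 s) = spmf_of_pmf (sample_sem m s)"
proof -
  have loop: "while_spmf (test_sem (RLess 4 7)) (\<lambda>s. exec S step_prog (tick 1 s)) (sample_start s k)
      = spmf_of_pmf (iter_pmf m step_sem (sample_start s k))" for k
  proof (rule while_spmf_eq_iter_pmf[where I = "walk_inv s (clock s + 3 + m * (7 * F)) m"])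
    show "\<not> test_sem (RLess 4 7) s'" if "walk_inv s (clock s + 3 + m * (7 * F)) m 0 s'" for s'
      using that by (auto simp: walk_inv_def)
    show "test_sem (RLess 4 7) s' \<and> exec S step_prog (tick 1 s') = spmf_of_pmf (step_sem s')"
      if "walk_inv s (clock s + 3 + m * (7 * F)) m (Suc j) s'" for j s'
      using that by (auto simp: walk_inv_def exec_step_prog simp del: One_nat_def)
  qed (auto intro: walk_inv_step walk_inv_sample_start s)
  have start: "tick 1 (rset 4 0 (tick 1 (nset 3 k (tick 1 s)))) = sample_start s k" for k
    by (simp add: tick_def rset_def nset_def sample_start_def)
  have fin: "tick 1 (rset 5 (rmem s 5 + rmem s 6) (tick 1 s)) = sample_end s" for s
    by (simp add: tick_def rset_def sample_end_def)
  have rmem_tick: "rmem (tick c s) = rmem s" for c s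
    by (simp add: tick_def)
  have "exec S sample_prog (tick 1 s) = bind_pmf (vec_sample t) (\<lambda>k. bind_spmf (map_spmf (tick 1)
      (while_spmf (test_sem (RLess 4 7)) (\<lambda>s. exec S step_prog (tick 1 s)) (sample_start s k)))
      (exec S (Do (RAdd 5 5 6))))"
    unfolding start[symmetric] by (simp add: sample_prog_def bind_map_pmf del: One_nat_def)
  also have "\<dots> = spmf_of_pmf (sample_sem m s)"
    unfolding loop sample_sem_def
    by (simp add: spmf_of_pmf_bind bind_map_pmf rmem_tick fin bind_pmf_return_spmf map_pmf_comp
        del: One_nat_def)
  finally show ?thesis .
qed

lemma finite_set_iter_step: "finite (set_pmf (iter_pmf m step_sem s))"
  by (rule finite_set_iter_pmf[OF finite_set_step_sem])

lemma finite_set_sample_sem: "finite (set_pmf (sample_sem m s))"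
  by (simp add: sample_sem_def finite_set_vec_sample finite_set_iter_step)

lemma sample_semD:
  assumes s: "rmem s 6 = 1" "rmem s 7 = real m" and s': "s' \<in> set_pmf (sample_sem m s)"
  shows "rmem s' 5 = rmem s 5 + 1"
    and "r \<notin> {3, 4, 5, 9, 10} \<Longrightarrow> rmem s' r = rmem s r"
    and "clock s' \<le> clock s + (5 + m * (7 * F))"
proof -
  obtain k u where u: "u \<in> set_pmf (iter_pmf m step_sem (sample_start s k))" "s' = sample_end u"
    using s' by (auto simp: sample_sem_def)
  have "walk_inv s (clock s + 3 + m * (7 * F)) m 0 u"
    using iter_pmf_invariant[of "walk_inv s (clock s + 3 + m * (7 * F)) m", OF walk_inv_step
        walk_inv_sample_start[OF s] u(1)] .
  then show "rmem s' 5 = rmem s 5 + 1" "clock s' \<le> clock s + (5 + m * (7 * F))"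
    "r \<notin> {3, 4, 5, 9, 10} \<Longrightarrow> rmem s' r = rmem s r"
    by (auto simp: walk_inv_def u(2) sample_end_def)
qed

section \<open>Moments of the reward of one sampled walk\<close>

abbreviation X :: real where
  "X \<equiv> 2 * p_norm \<infinity> (x_star M b)"

definition sample_mean :: "nat \<Rightarrow> real" where
  "sample_mean m = (\<Sum>i<n. t $ i * walk_reward (walk_step M) reward m i) / p_norm 1 t"

lemma sample_mean_le: "sample_mean m \<le> X"
proof -
  have "(\<Sum>i<n. t $ i * walk_reward (walk_step M) reward m i) \<le> (\<Sum>i<n. t $ i * X)"
    by (intro sum_mono mult_left_mono walk_reward_le) (auto simp: t_nonneg)
  also have "\<dots> = X * p_norm 1 t"
    by (simp add: p_norm_1_t sum_distrib_left mult_ac)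
  finally show "sample_mean m \<le> X"
    using p_norm_1_t_pos by (simp add: sample_mean_def pos_divide_le_eq)
qed

text \<open>Averaging the bounds for a fixed starting vertex keeps the second moment linear in the
  mean. The variance is at most the second moment, and \<open>sample_mean_le\<close> bounds the mean
  by \<open>X\<close>.\<close>

lemma sample_sem_moments:
  shows "measure_pmf.expectation (sample_sem m s) (\<lambda>s'. rmem s' 3 - rmem s 3) = sample_mean m"
    and "measure_pmf.expectation (sample_sem m s) (\<lambda>s'. (rmem s' 3 - rmem s 3 - sample_mean m)\<^sup>2)
      \<le> 2 * X\<^sup>2"
proof -
  note walk = iter_pmf_walk_reward[where f = step_sem and pos = "\<lambda>s. nmem s 3" and K = "walk_step M"
      and d = "\<lambda>s. rmem s 3" and y = reward and X = X and m = m, OF finite_set_step_sem map_step_sem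
      step_semD(1) reward_nonneg walk_reward_le]
  have start: "rmem (sample_start s k) 3 = rmem s 3" "nmem (sample_start s k) 3 = k" for k
    by (auto simp: sample_start_def)
  have fin: "rmem (sample_end u) 3 = rmem u 3" for u
    by (simp add: sample_end_def)
  have expand: "measure_pmf.expectation (sample_sem m s) (\<lambda>s'. h (rmem s' 3 - rmem s 3))
      = measure_pmf.expectation (vec_sample t) (\<lambda>k. measure_pmf.expectation
          (iter_pmf m step_sem (sample_start s k)) (\<lambda>s'. h (rmem s' 3 - rmem (sample_start s k) 3)))"
    for h :: "real \<Rightarrow> real"
    unfolding sample_sem_def
    by (subst expectation_bind_pmf_finite)
      (auto simp: finite_set_vec_sample finite_set_iter_step start fin)
  show mean: "measure_pmf.expectation (sample_sem m s) (\<lambda>s'. rmem s' 3 - rmem s 3) = sample_mean m"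
    using expand[of "\<lambda>x. x"] walk(1)
    by (simp add: start(2) expectation_vec_sample sample_mean_def)
  have "measure_pmf.expectation (sample_sem m s) (\<lambda>s'. (rmem s' 3 - rmem s 3)\<^sup>2)
      \<le> measure_pmf.expectation (vec_sample t) (\<lambda>k. 2 * X * walk_reward (walk_step M) reward m k)"
    unfolding expand[of "\<lambda>x. x\<^sup>2"]
    using walk(2)[of "sample_start s _"]
    by (intro expectation_mono_pmf_finite finite_set_vec_sample) (simp add: start(2))
  also have "\<dots> = 2 * X * sample_mean m"
    by (simp add: expectation_vec_sample sample_mean_def sum_distrib_left mult_ac)
  finally have second: "measure_pmf.expectation (sample_sem m s) (\<lambda>s'. (rmem s' 3 - rmem s 3)\<^sup>2)
      \<le> 2 * X * sample_mean m" .
  have "measure_pmf.expectation (sample_sem m s) (\<lambda>s'. (rmem s' 3 - rmem s 3 - sample_mean m)\<^sup>2)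
      = measure_pmf.expectation (sample_sem m s) (\<lambda>s'. (rmem s' 3 - rmem s 3)\<^sup>2) - (sample_mean m)\<^sup>2"
    using expectation_square_shift[OF finite_set_sample_sem, of m s "\<lambda>s'. rmem s' 3 - rmem s 3"
        "- sample_mean m"] mean by (simp add: power2_eq_square)
  also have "\<dots> \<le> 2 * X * sample_mean m"
    using second zero_le_power2[of "sample_mean m"] by linarith
  also have "\<dots> \<le> 2 * X\<^sup>2"
    using sample_mean_le p_norm_x_star_pos by (simp add: power2_eq_square)
  finally show "measure_pmf.expectation (sample_sem m s)
    (\<lambda>s'. (rmem s' 3 - rmem s 3 - sample_mean m)\<^sup>2) \<le> 2 * X\<^sup>2" .
qed

section \<open>The loop over the walks\<close>

definition loop_inv :: "real \<Rightarrow> nat \<Rightarrow> nat \<Rightarrow> nat \<Rightarrow> nat \<Rightarrow> state \<Rightarrow> bool" where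
  "loop_inv B c m N j s \<longleftrightarrow> rmem s 2 = p_norm 1 t \<and> rmem s 6 = 1 \<and> rmem s 7 = real m \<and> rmem s 8 = B \<and>
    rmem s 5 + real j = real N \<and> clock s + j * (5 + m * (7 * F)) \<le> c"

lemma loop_inv_step:
  assumes "loop_inv B c m N (Suc j) s" and "s' \<in> set_pmf (sample_sem m s)"
  shows "loop_inv B c m N j s'"
proof -
  have "rmem s 6 = 1" "rmem s 7 = real m"
    using assms(1) by (auto simp: loop_inv_def)
  from sample_semD[OF this assms(2)] assms(1) show ?thesis
    by (auto simp: loop_inv_def)
qed

definition final :: "state \<Rightarrow> state" where
  "final s = s\<lparr>rmem := (rmem s)(5 := 2 * rmem s 5, 0 := rmem s 2 * rmem s 3 / (2 * rmem s 5)),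
    clock := clock s + 4\<rparr>"

text \<open>The two inequalities make \<open>N\<close> the ceiling of the real number in cell 8:
  \<open>RLess 5 8\<close> succeeds at the counts 0 to N - 1 and fails at N. The 13 units of time
  are the test of \<open>If\<close> and the twelve instructions of \<open>init_prog\<close>.\<close>

lemma exec_estimator:
  assumes "\<epsilon> < p_norm 1 t"
    and N: "real N - 1 < 128 * (p_norm 1 t)\<^sup>2 / \<epsilon>\<^sup>2" "128 * (p_norm 1 t)\<^sup>2 / \<epsilon>\<^sup>2 \<le> real N"
  obtains s where "rmem s 3 = 0"
    and "loop_inv (128 * (p_norm 1 t)\<^sup>2 / \<epsilon>\<^sup>2) (13 + N * (5 + K * L * (7 * F))) (K * L) N N s"
    and "exec S (estimator K) (initial S L \<epsilon> \<gamma>)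
      = spmf_of_pmf (map_pmf final (iter_pmf N (sample_sem (K * L)) s))"
proof -
  let ?B = "128 * (p_norm 1 t)\<^sup>2 / \<epsilon>\<^sup>2" and ?c = "13 + N * (5 + K * L * (7 * F))"
  have "\<exists>s. exec S (init_prog K) (tick 1 (initial S L \<epsilon> \<gamma>)) = return_spmf s \<and>
      rmem s 2 = p_norm 1 t \<and> rmem s 3 = 0 \<and> rmem s 5 = 0 \<and> rmem s 6 = 1 \<and>
      rmem s 7 = real (K * L) \<and> rmem s 8 = ?B \<and> clock s = 13"
    by (simp add: init_prog_def initial_def tick_def nset_def rset_def power2_eq_square)
  then obtain s where s: "exec S (init_prog K) (tick 1 (initial S L \<epsilon> \<gamma>)) = return_spmf s"
    "rmem s 2 = p_norm 1 t" "rmem s 3 = 0" "rmem s 5 = 0" "rmem s 6 = 1"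
    "rmem s 7 = real (K * L)" "rmem s 8 = ?B" "clock s = 13"
    by blast
  then have inv: "loop_inv ?B ?c (K * L) N N s"
    by (simp add: loop_inv_def)
  have loop: "while_spmf (test_sem (RLess 5 8)) (\<lambda>s. exec S sample_prog (tick 1 s)) s
      = spmf_of_pmf (iter_pmf N (sample_sem (K * L)) s)"
  proof (rule while_spmf_eq_iter_pmf[where I = "loop_inv ?B ?c (K * L) N"])
    show "\<not> test_sem (RLess 5 8) s'" if "loop_inv ?B ?c (K * L) N 0 s'" for s'
      using that N by (auto simp: loop_inv_def)
    show "test_sem (RLess 5 8) s' \<and> exec S sample_prog (tick 1 s') = spmf_of_pmf (sample_sem (K * L) s')"
      if "loop_inv ?B ?c (K * L) N (Suc j) s'" for j s'
    proof
      have "rmem s' 5 = real N - real (Suc j)" "rmem s' 8 = ?B"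
        using that by (auto simp: loop_inv_def)
      then show "test_sem (RLess 5 8) s'"
        using N by simp
      show "exec S sample_prog (tick 1 s') = spmf_of_pmf (sample_sem (K * L) s')"
        using that by (intro exec_sample_prog) (auto simp: loop_inv_def)
    qed
  qed (use inv in \<open>auto intro: loop_inv_step\<close>)
  have fin: "exec S final_prog (tick 1 s) = return_spmf (final s)" for s
    by (simp add: final_prog_def final_def tick_def rset_def)
  have "test_sem (RLess 0 2) (initial S L \<epsilon> \<gamma>)"
    using assms(1) by (simp add: initial_def)
  then have "exec S (estimator K) (initial S L \<epsilon> \<gamma>)
      = bind_spmf (map_spmf (tick 1) (while_spmf (test_sem (RLess 5 8)) (\<lambda>s. exec S sample_prog (tick 1 s)) s))
          (exec S final_prog)"
    unfolding estimator_def using s(1) by (simp del: One_nat_def test_sem.simps)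
  also have "\<dots> = spmf_of_pmf (map_pmf final (iter_pmf N (sample_sem (K * L)) s))"
    unfolding loop by (simp add: bind_map_pmf fin bind_pmf_return_spmf del: One_nat_def)
  finally show ?thesis
    using that s(3) inv by blast
qed

text \<open>This is Chebyshev's inequality, obtained from Markov's inequality for the squared
  deviation; the variances of the walks add up by \<open>iter_pmf_mean_variance\<close>.\<close>

lemma iter_sample_concentration:
  assumes "loop_inv B c m N N s" and "0 < \<delta>"
  shows "measure_pmf.prob (iter_pmf N (sample_sem m) s) {s'. \<bar>rmem s' 3 - rmem s 3 - real N * sample_mean m\<bar> < \<delta>}
    \<ge> 1 - real N * (2 * X\<^sup>2) / \<delta>\<^sup>2"
proof -
  let ?p = "iter_pmf N (sample_sem m) s" and ?f = "\<lambda>s'. rmem s' 3 - rmem s 3 - real N * sample_mean m"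
  have fin: "finite (set_pmf ?p)"
    by (rule finite_set_iter_pmf[OF finite_set_sample_sem])
  have "measure_pmf.prob ?p {s' \<in> space ?p. (?f s')\<^sup>2 \<ge> \<delta>\<^sup>2}
      \<le> measure_pmf.expectation ?p (\<lambda>s'. (?f s')\<^sup>2) / \<delta>\<^sup>2"
    using fin assms(2)
    by (intro integral_Markov_inequality_measure[where A = "{}"] integrable_measure_pmf_finite) auto
  also have "\<dots> \<le> real N * (2 * X\<^sup>2) / \<delta>\<^sup>2"
    using iter_pmf_mean_variance(2)[where I = "loop_inv B c m N" and d = "\<lambda>s. rmem s 3",
        OF finite_set_sample_sem loop_inv_step sample_sem_moments assms(1)]
    by (intro divide_right_mono) auto
  also have "{s' \<in> space ?p. (?f s')\<^sup>2 \<ge> \<delta>\<^sup>2} = space ?p - {s'. \<bar>?f s'\<bar> < \<delta>}"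
  proof -
    have "\<delta>\<^sup>2 \<le> a\<^sup>2 \<longleftrightarrow> \<not> \<bar>a\<bar> < \<delta>" for a
      using abs_le_square_iff[of \<delta> a] assms(2) by (simp add: not_less)
    then show ?thesis by auto
  qed
  also have "measure_pmf.prob ?p (space ?p - {s'. \<bar>?f s'\<bar> < \<delta>})
      = 1 - measure_pmf.prob ?p {s'. \<bar>?f s'\<bar> < \<delta>}"
    by (rule measure_pmf.prob_compl) simp
  finally show ?thesis by linarith
qed

lemma scalar_prod_x_star_bounds: "\<bar>t \<bullet> x_star M b\<bar> \<le> p_norm 1 t * p_norm \<infinity> (x_star M b)"
proof -
  have "\<bar>t \<bullet> x_star M b\<bar> \<le> (\<Sum>i<n. \<bar>t $ i * x_star M b $ i\<bar>)"
    using x_star_carrier by (simp add: scalar_prod_def atLeast0LessThan)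
  also have "\<dots> \<le> (\<Sum>i<n. t $ i * p_norm \<infinity> (x_star M b))"
    unfolding abs_mult using x_star_carrier t_nonneg
    by (intro sum_mono mult_mono abs_le_p_norm) auto
  finally show ?thesis
    by (simp add: p_norm_1_t sum_distrib_right)
qed

lemma estimator_correct:
  assumes \<epsilon>: "0 < \<epsilon>" and L: "1 \<le> L" and K: "1 \<le> K"
    and m: "ln (log_arg M b t \<gamma> (\<epsilon> * p_norm \<infinity> (x_star M b))) \<le> 2/3 * \<gamma> * real (K * L)"
  obtains p where "exec S (estimator K) (initial S L \<epsilon> \<gamma>) = spmf_of_pmf p"
    and "3/4 \<le> measure_pmf.prob p {s. \<bar>result s - t \<bullet> x_star M b\<bar> \<le> \<epsilon> * p_norm \<infinity> (x_star M b)}"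
    and "\<And>s. s \<in> set_pmf p \<Longrightarrow>
      real (clock s) \<le> 1565 * real K * max 1 (real F * (p_norm 1 t)\<^sup>2 * (real L)\<^sup>2 / \<epsilon>\<^sup>2)"
proof (cases "\<epsilon> < p_norm 1 t")
  case False
  let ?s = "tick 1 (rset 0 0 (tick 1 (initial S L \<epsilon> \<gamma>)))"
  have "exec S (estimator K) (initial S L \<epsilon> \<gamma>) = spmf_of_pmf (return_pmf ?s)"
    using False by (simp add: estimator_def initial_def tick_def rset_def)
  moreover have "\<bar>result ?s - t \<bullet> x_star M b\<bar> \<le> \<epsilon> * p_norm \<infinity> (x_star M b)"
  proof -
    have "p_norm 1 t * p_norm \<infinity> (x_star M b) \<le> \<epsilon> * p_norm \<infinity> (x_star M b)"
      using False p_norm_x_star_pos by (intro mult_right_mono) auto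
    then show ?thesis
      using scalar_prod_x_star_bounds by (simp add: result_def rset_def tick_def)
  qed
  moreover have "real (clock ?s) \<le> 1565 * real K * max 1 (real F * (p_norm 1 t)\<^sup>2 * (real L)\<^sup>2 / \<epsilon>\<^sup>2)"
  proof -
    have "2 \<le> 1565 * real K * 1"
      using K by simp
    also have "\<dots> \<le> 1565 * real K * max 1 (real F * (p_norm 1 t)\<^sup>2 * (real L)\<^sup>2 / \<epsilon>\<^sup>2)"
      by (intro mult_left_mono) auto
    finally show ?thesis
      by (simp add: tick_def rset_def initial_def)
  qed
  ultimately show ?thesis
    using that[of "return_pmf ?s"] by simp
next
  case True
  define m where "m = K * L"
  define R where "R = (p_norm 1 t)\<^sup>2 / \<epsilon>\<^sup>2"
  define N where "N = nat \<lceil>128 * R\<rceil>"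
  have R: "1 \<le> R"
    using True \<epsilon> by (auto simp: R_def intro!: power_mono)
  have N: "real N - 1 < 128 * R" "128 * R \<le> real N" "0 < real N"
    using R by (auto simp: N_def) linarith+
  obtain s where s: "rmem s 3 = 0" "loop_inv (128 * R) (13 + N * (5 + m * (7 * F))) m N N s"
    "exec S (estimator K) (initial S L \<epsilon> \<gamma>) = spmf_of_pmf (map_pmf final (iter_pmf N (sample_sem m) s))"
    using exec_estimator[OF True, of N K L] N unfolding R_def m_def by auto
  let ?p = "iter_pmf N (sample_sem m) s" and ?E = "\<epsilon> * p_norm \<infinity> (x_star M b)"
  let ?\<mu> = "sample_mean m"
  \<comment> \<open>The output is the total reward times \<open>p_norm 1 t / (2 * real N)\<close>,
    so a deviation of the total by \<open>\<delta>\<close> changes it by exactly a quarter of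
    \<open>?E\<close>.\<close>
  define \<delta> where "\<delta> = real N * ?E / (2 * p_norm 1 t)"
  have E: "0 < ?E"
    using \<epsilon> p_norm_x_star_pos by simp
  have \<delta>: "0 < \<delta>"
    using N E p_norm_1_t_pos by (simp add: \<delta>_def)
  have inv: "loop_inv (128 * R) (13 + N * (5 + m * (7 * F))) m N 0 s'" if "s' \<in> set_pmf ?p" for s'
    using iter_pmf_invariant[of "loop_inv (128 * R) (13 + N * (5 + m * (7 * F))) m N",
        OF loop_inv_step s(2) that] .
  \<comment> \<open>The origin of the constant 128 in \<open>init_prog\<close>: \<open>N\<close>
    must be at least \<open>128 * R\<close> for this failure probability to be at most 1/4.\<close>
  have "real N * (2 * X\<^sup>2) / \<delta>\<^sup>2 = 32 * R / real N"
    using N p_norm_x_star_pos p_norm_1_t_pos \<epsilon> by (simp add: \<delta>_def R_def field_simps power2_eq_square)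
  also have "\<dots> \<le> 1/4"
    using N by (simp add: field_simps)
  finally have "3/4 \<le> 1 - real N * (2 * X\<^sup>2) / \<delta>\<^sup>2"
    by simp
  also have "\<dots> \<le> measure_pmf.prob ?p {s'. \<bar>rmem s' 3 - rmem s 3 - real N * ?\<mu>\<bar> < \<delta>}"
    by (rule iter_sample_concentration[OF s(2) \<delta>])
  also have "\<dots> \<le> measure_pmf.prob (map_pmf final ?p) {s. \<bar>result s - t \<bullet> x_star M b\<bar> \<le> ?E}"
    unfolding measure_map_pmf
  proof (rule measure_pmf.finite_measure_mono_AE)
    show "AE s' in ?p. s' \<in> {s'. \<bar>rmem s' 3 - rmem s 3 - real N * ?\<mu>\<bar> < \<delta>} \<longrightarrow>
      s' \<in> final -` {s. \<bar>result s - t \<bullet> x_star M b\<bar> \<le> ?E}"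
    proof (unfold AE_measure_pmf_iff, intro ballI impI)
      fix s' assume s': "s' \<in> set_pmf ?p" 
        and "s' \<in> {s'. \<bar>rmem s' 3 - rmem s 3 - real N * ?\<mu>\<bar> < \<delta>}"
      then have dev: "\<bar>rmem s' 3 - rmem s 3 - real N * ?\<mu>\<bar> < \<delta>"
        by simp
      have "rmem s' 2 = p_norm 1 t" "rmem s' 5 = real N"
        using inv[OF s'] by (auto simp: loop_inv_def)
      then have "result (final s') = p_norm 1 t * rmem s' 3 / (2 * real N)"
        by (simp add: result_def final_def)
      then have "result (final s') - 1/2 * (p_norm 1 t * ?\<mu>)
          = (p_norm 1 t / (2 * real N)) * (rmem s' 3 - rmem s 3 - real N * ?\<mu>)"
        using N s(1) by (simp add: field_simps)
      then have "\<bar>result (final s') - 1/2 * (p_norm 1 t * ?\<mu>)\<bar>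
          = (p_norm 1 t / (2 * real N)) * \<bar>rmem s' 3 - rmem s 3 - real N * ?\<mu>\<bar>"
        using N p_norm_1_t_pos by (simp add: abs_mult)
      also have "\<dots> \<le> (p_norm 1 t / (2 * real N)) * \<delta>"
        using N p_norm_1_t_pos dev by (intro mult_left_mono) auto
      also have "\<dots> = 1/4 * ?E"
        using N p_norm_1_t_pos by (simp add: \<delta>_def)
      finally have "\<bar>result (final s') - 1/2 * (p_norm 1 t * ?\<mu>)\<bar> \<le> 1/4 * ?E" .
      moreover have "p_norm 1 t * ?\<mu> = (\<Sum>i<n. t $ i * walk_reward (walk_step M) reward m i)"
        using p_norm_1_t_pos by (simp add: sample_mean_def)
      then have "\<bar>1/2 * (p_norm 1 t * ?\<mu>) - t \<bullet> x_star M b\<bar> \<le> 3/4 * ?E"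
        using truncation_error[OF E m] by (simp only: m_def)
      ultimately have "\<bar>result (final s') - t \<bullet> x_star M b\<bar> \<le> ?E"
        by linarith
      then show "s' \<in> final -` {s. \<bar>result s - t \<bullet> x_star M b\<bar> \<le> ?E}"
        by simp
    qed
  qed simp
  finally have prob: "3/4 \<le> measure_pmf.prob (map_pmf final ?p) {s. \<bar>result s - t \<bullet> x_star M b\<bar> \<le> ?E}" .
  have "real (clock u) \<le> 1565 * real K * max 1 (real F * (p_norm 1 t)\<^sup>2 * (real L)\<^sup>2 / \<epsilon>\<^sup>2)"
    if u: "u \<in> set_pmf (map_pmf final ?p)" for u
  proof -
    obtain s' where s': "s' \<in> set_pmf ?p" "u = final s'"
      using u by auto
    have mF: "1 \<le> m * F"
      using K L F_pos by (simp add: m_def)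
    then have mF': "1 \<le> real m * real F"
      by (metis of_nat_1 of_nat_le_iff of_nat_mult)
    have "clock s' \<le> 13 + N * (5 + m * (7 * F))"
      using inv[OF s'(1)] by (simp add: loop_inv_def)
    then have "clock u \<le> 17 + N * (5 + m * (7 * F))"
      by (simp add: s'(2) final_def)
    also have "\<dots> \<le> 17 + N * (12 * (m * F))"
      using mF by simp
    finally have "real (clock u) \<le> 17 + real N * (12 * (real m * real F))"
      by (metis (mono_tags) of_nat_add of_nat_le_iff of_nat_mult of_nat_numeral)
    \<comment> \<open>As \<open>R\<close> is at least 1, the ceiling \<open>N\<close> is at most
      \<open>129 * R\<close>; the final constant is 17 + 129 * 12 = 1565.\<close>
    also have "\<dots> \<le> 17 * (R * (real m * real F)) + 129 * R * (12 * (real m * real F))"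
    proof (intro add_mono mult_right_mono)
      have "1 \<le> R * (real m * real F)"
        using mult_mono[OF R mF'] R by simp
      then show "17 \<le> 17 * (R * (real m * real F))" by simp
    qed (use N R in auto)
    also have "\<dots> = 1565 * real K * (real F * R * real L)"
      by (simp add: m_def algebra_simps)
    also have "\<dots> \<le> 1565 * real K * (real F * R * (real L)\<^sup>2)"
      using L R by (intro mult_left_mono) (auto simp: power2_eq_square)
    also have "\<dots> \<le> 1565 * real K * max 1 (real F * (p_norm 1 t)\<^sup>2 * (real L)\<^sup>2 / \<epsilon>\<^sup>2)"
      by (intro mult_left_mono) (auto simp: R_def)
    finally show ?thesis .
  qed
  then show ?thesis
    using that[OF s(3) prob] by blast
qed

text \<open>By \<open>p_norm_x_star_ge\<close> the norm of the solution in the target accuracy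
  cancels the norm of D^(-1) b up to a factor 2. Of the remaining factors of \<open>H\<close>,
  \<open>d_max M\<close> is at most q, the norm of D^(-1) t at most q^2, and each
  \<open>norm0\<close> at most n.\<close>

lemma log_arg_le:
  assumes \<epsilon>: "0 < \<epsilon>" and q: "0 < q"
    and M_le: "\<And>i. i < n \<Longrightarrow> 1 / q \<le> M $$ (i, i) \<and> M $$ (i, i) \<le> q"
    and t_le: "\<And>i. i < n \<Longrightarrow> t $ i \<le> q"
  shows "log_arg M b t \<gamma> (\<epsilon> * p_norm \<infinity> (x_star M b)) \<le> 2 * (1 / \<gamma>) * (1 / \<epsilon>) * (real n)\<^sup>2 * q ^ 3"
proof -
  let ?X = "p_norm \<infinity> (x_star M b)"
  have dim: "dim_vec t = n" "dim_vec b = n"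
    using t b by auto
  have d: "d_max M \<le> q"
    using M M_le n_pos by (auto simp: d_max_def intro!: Max.boundedI)
  have "p_norm \<infinity> (diag_inv M *\<^sub>v t) \<le> q * q"
  proof (rule p_norm_infinity_le)
    fix i assume "i < dim_vec (diag_inv M *\<^sub>v t)"
    then have i: "i < n" using M by simp
    have "1 \<le> q * M $$ (i, i)"
      using M_le[OF i] q by (simp add: field_simps)
    then have "t $ i * 1 \<le> q * (q * M $$ (i, i))"
      using t_le[OF i] t_nonneg[OF i] q by (intro mult_mono) auto
    then show "\<bar>(diag_inv M *\<^sub>v t) $ i\<bar> \<le> q * q"
      using t_nonneg[OF i] diag_pos[OF i] by (simp add: diag_inv_mult_index[OF t i] field_simps)
  qed (use M n_pos in simp)
  then have "H \<le> q * real n * (q * q) * real n * (2 * ?X)"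
    unfolding H_def using d_max_pos d norm0_le[of t] norm0_le[of b] p_norm_x_star_ge q dim M n_pos
    by (intro mult_mono mult_nonneg_nonneg p_norm_nonneg) auto
  then have "H / (\<gamma> * (\<epsilon> * ?X)) \<le> q * real n * (q * q) * real n * (2 * ?X) / (\<gamma> * (\<epsilon> * ?X))"
    using \<epsilon> \<gamma>_pos p_norm_x_star_pos by (intro divide_right_mono) auto
  also have "\<dots> = 2 * (1 / \<gamma>) * (1 / \<epsilon>) * (real n)\<^sup>2 * q ^ 3"
    using p_norm_x_star_pos by (simp add: power2_eq_square power3_eq_cube)
  finally show ?thesis
    by (simp add: log_arg_eq)
qed

end

section \<open>The polylogarithmic form of the running time\<close>

lemma poly_le_power:
  fixes p :: "real poly"
  assumes "1 \<le> y" and "0 \<le> x" and "x \<le> y"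
  shows "poly p x \<le> (\<Sum>i\<le>degree p. \<bar>coeff p i\<bar>) * y ^ degree p"
proof -
  have "poly p x \<le> (\<Sum>i\<le>degree p. \<bar>coeff p i\<bar> * y ^ degree p)"
    unfolding poly_altdef
  proof (intro sum_mono)
    fix i assume "i \<in> {..degree p}"
    then have "x ^ i \<le> y ^ degree p"
      using assms power_mono[of x y i] power_increasing[of i "degree p" y] by simp
    then have "\<bar>coeff p i\<bar> * x ^ i \<le> \<bar>coeff p i\<bar> * y ^ degree p"
      by (rule mult_left_mono) simp
    moreover have "coeff p i * x ^ i \<le> \<bar>coeff p i\<bar> * x ^ i"
      using assms by (intro mult_right_mono) auto
    ultimately show "coeff p i * x ^ i \<le> \<bar>coeff p i\<bar> * y ^ degree p"
      by linarith
  qed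
  then show ?thesis
    by (simp add: sum_distrib_right)
qed

text \<open>Because \<open>y\<close> is at least 2, the ratio \<open>ln y / ln 2\<close> is at least
  1; this absorbs the constants 1 and \<open>3 * ln A\<close> into a multiple of
  \<open>ln y\<close>.\<close>

lemma max_1_ln_le:
  fixes y A :: real
  assumes y: "2 \<le> y" and A: "1 \<le> A" and a: "0 < a" "a \<le> y ^ 5 * (A * y ^ g) ^ 3"
  shows "max 1 (ln a) \<le> (5 + 3 * real g + (1 + 3 * ln A) / ln 2) * ln y"
proof -
  define r where "r = ln y / ln 2"
  have r: "1 \<le> r"
    using y by (simp add: r_def)
  have A0: "0 \<le> ln A" and y0: "0 \<le> ln y"
    using A y by auto
  define w where "w = ln A * r"
  define v where "v = real g * ln y"
  have w: "ln A \<le> w" and v: "0 \<le> v"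
    using A0 y0 mult_left_mono[OF r, of "ln A"] by (simp_all add: w_def v_def)
  have rhs: "(5 + 3 * real g + (1 + 3 * ln A) / ln 2) * ln y = 5 * ln y + 3 * w + 3 * v + r"
    by (simp add: r_def w_def v_def field_simps)
  have "ln a \<le> ln (y ^ 5 * (A * y ^ g) ^ 3)"
    using a y A by (subst ln_le_cancel_iff) auto
  also have "\<dots> = 5 * ln y + 3 * ln A + 3 * v"
    using y A by (simp add: ln_mult ln_realpow v_def)
  finally show ?thesis
    unfolding rhs using r A0 y0 w v by linarith
qed

theorem theorem1p5:
  fixes c\<^sub>1 c\<^sub>2 :: real and pl :: "real poly"
  assumes "0 < c\<^sub>1" and "c\<^sub>1 \<le> c\<^sub>2"
  shows "\<exists>(P :: prog) (C :: real) (C' :: real) (k :: nat).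
    \<forall>(n :: nat) (M :: real mat) (b :: real vec) (t :: real vec) (\<tau> :: nat \<Rightarrow> nat)
      (\<epsilon> :: real) (\<gamma> :: real) (L :: nat) (S :: lin_sys) (x :: real vec) (out :: state spmf).
      setting pl n M b t \<and> RDDZ M \<and>
      (\<forall>i<n. b $ i \<ge> 0) \<and> (\<forall>i<n. t $ i \<ge> 0) \<and>
      (\<forall>j<n. \<tau> j \<ge> 1) \<and>
      0 < \<epsilon> \<and> 0 < \<gamma> \<and> \<gamma> \<le> gamma_max M \<and>
      x = x_star M b \<and>
      1 \<le> L \<and>
      c\<^sub>1 * (1 / \<gamma> * ln (log_arg M b t \<gamma> (\<epsilon> * p_norm \<infinity> x))) \<le> real L \<and>
      real L \<le> c\<^sub>2 * (1 / \<gamma> * max 1 (ln (log_arg M b t \<gamma> (\<epsilon> * p_norm \<infinity> x)))) \<and>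
      S = \<lparr>mtx = M, rhs = b, tgt = t, step_time = \<tau>\<rparr> \<and>
      out = exec S P (initial S L \<epsilon> \<gamma>)
      \<longrightarrow>
      lossless_spmf out \<and>
      measure (measure_spmf out) {s. \<bar>result s - t \<bullet> x\<bar> \<le> \<epsilon> * p_norm \<infinity> x} \<ge> 3 / 4 \<and>
      (\<forall>s\<in>set_spmf out.
         real (clock s) \<le> C * max 1 (real (f_row S) * (p_norm 1 t)\<^sup>2 * (real L)\<^sup>2 / \<epsilon>\<^sup>2) \<and>
         real (clock s) \<le> C' * max 1 (real (f_row S) * (p_norm 1 t)\<^sup>2 / (\<gamma>\<^sup>2 * \<epsilon>\<^sup>2)
                                   * (ln (2 + real n + 1 / \<gamma> + 1 / \<epsilon>)) ^ k))"
proof -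
  \<comment> \<open>Walks of length K L have to be long enough even for the smallest admissible
    \<open>L\<close>, which calls for \<open>3/2 \<le> c\<^sub>1 * real K\<close>. As
    \<open>K\<close> depends on \<open>c\<^sub>1\<close> alone, one program serves all
    inputs.\<close>
  define K where "K = Suc (nat \<lceil>3 / (2 * c\<^sub>1)\<rceil>)"
  define A where "A = 1 + (\<Sum>i\<le>degree pl. \<bar>coeff pl i\<bar>)"
  define C where "C = 1565 * real K"
  \<comment> \<open>Chosen so that L <= \<open>c\<^sub>2\<close> * D * ln y / \<gamma> for y = 2 + n
    + 1/\<gamma> + 1/\<epsilon>. Squaring this gives the exponent 2 of the logarithm and the factor
    in \<open>C'\<close>.\<close>
  define D where "D = 5 + 3 * real (degree pl) + (1 + 3 * ln A) / ln 2"
  define C' where "C' = C * max 1 ((c\<^sub>2 * D)\<^sup>2)"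
  have K: "1 \<le> K" "3/2 \<le> c\<^sub>1 * real K"
  proof -
    show "1 \<le> K"
      by (simp add: K_def)
    have "3 / (2 * c\<^sub>1) \<le> real K"
      using real_nat_ceiling_ge[of "3 / (2 * c\<^sub>1)"] by (simp add: K_def)
    then show "3/2 \<le> c\<^sub>1 * real K"
      using assms(1) by (simp add: field_simps)
  qed
  have A: "1 \<le> A"
    by (simp add: A_def sum_nonneg)
  show ?thesis
  proof (rule exI[of _ "estimator K"], rule exI[of _ C], rule exI[of _ C'], rule exI[of _ 2],
      intro allI impI, elim conjE)
    fix n :: nat and M :: "real mat" and b t :: "real vec" and \<tau> :: "nat \<Rightarrow> nat"
      and \<epsilon> \<gamma> :: real and L :: nat and S :: lin_sys and x :: "real vec" and out :: "state spmf"
    assume set: "setting pl n M b t" and RDDZ: "RDDZ M" and bt: "\<forall>i<n. b $ i \<ge> 0" "\<forall>i<n. t $ i \<ge> 0"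
      and \<tau>: "\<forall>j<n. \<tau> j \<ge> 1" and \<epsilon>: "0 < \<epsilon>" and \<gamma>: "0 < \<gamma>" "\<gamma> \<le> gamma_max M"
      and x: "x = x_star M b" and L: "1 \<le> L"
      and L_ge: "c\<^sub>1 * (1 / \<gamma> * ln (log_arg M b t \<gamma> (\<epsilon> * p_norm \<infinity> x))) \<le> real L"
      and L_le: "real L \<le> c\<^sub>2 * (1 / \<gamma> * max 1 (ln (log_arg M b t \<gamma> (\<epsilon> * p_norm \<infinity> x))))"
      and S: "S = \<lparr>mtx = M, rhs = b, tgt = t, step_time = \<tau>\<rparr>"
      and out: "out = exec S (estimator K) (initial S L \<epsilon> \<gamma>)"
    interpret rddz_machine n M b t \<gamma> \<tau>
      using set RDDZ bt \<tau> \<gamma> by unfold_locales (auto simp: setting_def)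
    let ?\<Lambda> = "log_arg M b t \<gamma> (\<epsilon> * p_norm \<infinity> (x_star M b))"
    have "ln ?\<Lambda> \<le> 2/3 * \<gamma> * real (K * L)"
    proof (cases "0 \<le> ln ?\<Lambda>")
      case True
      have "3/2 * ln ?\<Lambda> \<le> c\<^sub>1 * real K * ln ?\<Lambda>"
        using K(2) True by (rule mult_right_mono)
      also have "\<dots> = real K * (\<gamma> * (c\<^sub>1 * (1 / \<gamma> * ln ?\<Lambda>)))"
        using \<gamma> by simp
      also have "\<dots> \<le> real K * (\<gamma> * real L)"
        using L_ge \<gamma> unfolding x by (intro mult_left_mono) auto
      finally show ?thesis
        by (simp add: mult_ac)
    next
      case False
      moreover have "0 \<le> 2/3 * \<gamma> * real (K * L)"
        using \<gamma> by simp
      ultimately show ?thesis by linarith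
    qed
    then obtain p where p: "exec S (estimator K) (initial S L \<epsilon> \<gamma>) = spmf_of_pmf p"
      "3/4 \<le> measure_pmf.prob p {s. \<bar>result s - t \<bullet> x_star M b\<bar> \<le> \<epsilon> * p_norm \<infinity> (x_star M b)}"
      "\<And>s. s \<in> set_pmf p \<Longrightarrow>
        real (clock s) \<le> C * max 1 (real (f_row S) * (p_norm 1 t)\<^sup>2 * (real L)\<^sup>2 / \<epsilon>\<^sup>2)"
      using estimator_correct[OF \<epsilon> L K(1)] unfolding S C_def by metis
    let ?y = "2 + real n + 1 / \<gamma> + 1 / \<epsilon>"
    let ?G = "real (f_row S) * (p_norm 1 t)\<^sup>2 / (\<gamma>\<^sup>2 * \<epsilon>\<^sup>2) * (ln ?y)\<^sup>2"
    have y: "2 \<le> ?y" "real n \<le> ?y" "1 / \<gamma> \<le> ?y" "1 / \<epsilon> \<le> ?y"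
      using \<gamma> \<epsilon> by (simp_all add: add_nonneg_nonneg)
    have "max 1 (ln ?\<Lambda>) \<le> D * ln ?y"
      unfolding D_def
    proof (rule max_1_ln_le)
      show "0 < ?\<Lambda>"
        using H_pos \<gamma> \<epsilon> p_norm_x_star_pos by (simp add: log_arg_eq)
      let ?q = "poly pl (real n)"
      have M_bd: "1 / ?q \<le> M $$ (i, i) \<and> M $$ (i, i) \<le> ?q" if "i < n" for i
      proof -
        have "poly_bounded pl n (M $$ (i, i))"
          using set that by (simp add: setting_def)
        then show ?thesis
          using diag_pos[OF that] by (simp add: poly_bounded_def)
      qed
      have q: "0 < ?q"
        using M_bd[OF n_pos] diag_pos[OF n_pos] by linarith
      have "t $ i \<le> ?q" if "i < n" for i
      proof -
        have "poly_bounded pl n (t $ i)"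
          using set that by (simp add: setting_def)
        then show ?thesis
          using q by (cases "t $ i = 0") (auto simp: poly_bounded_def)
      qed
      then have "?\<Lambda> \<le> 2 * (1 / \<gamma>) * (1 / \<epsilon>) * (real n)\<^sup>2 * ?q ^ 3"
        using log_arg_le[OF \<epsilon> q] M_bd by blast
      \<comment> \<open>The factors 2, 1/\<gamma> and 1/\<epsilon> are each at most
        \<open>?y\<close> and n^2 is at most its square, whence the fifth power.\<close>
      also have "\<dots> \<le> ?y * ?y * ?y * ?y\<^sup>2 * (A * ?y ^ degree pl) ^ 3"
      proof (intro mult_mono power_mono)
        have "?q \<le> (\<Sum>i\<le>degree pl. \<bar>coeff pl i\<bar>) * ?y ^ degree pl"
          using y by (intro poly_le_power) auto
        also have "\<dots> \<le> A * ?y ^ degree pl"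
          using y by (intro mult_right_mono) (auto simp: A_def)
        finally show "?q \<le> A * ?y ^ degree pl" .
      qed (use y \<gamma> \<epsilon> q in \<open>auto intro!: mult_nonneg_nonneg\<close>)
      also have "\<dots> = ?y ^ 5 * (A * ?y ^ degree pl) ^ 3"
      proof -
        have "y * y * y * y\<^sup>2 = y ^ 5" for y :: real
          by (simp add: eval_nat_numeral)
        then show ?thesis by (simp only:)
      qed
      finally show "?\<Lambda> \<le> ?y ^ 5 * (A * ?y ^ degree pl) ^ 3" .
    qed (use y A in auto)
    then have "c\<^sub>2 * (1 / \<gamma> * max 1 (ln ?\<Lambda>)) \<le> c\<^sub>2 * (1 / \<gamma> * (D * ln ?y))"
      using assms \<gamma> by (intro mult_left_mono) auto
    then have "real L \<le> c\<^sub>2 * D * ln ?y / \<gamma>"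
      using L_le unfolding x by (simp add: mult_ac)
    then have "(real L)\<^sup>2 \<le> (c\<^sub>2 * D * ln ?y / \<gamma>)\<^sup>2"
      by (intro power_mono) auto
    then have "real (f_row S) * (p_norm 1 t)\<^sup>2 * (real L)\<^sup>2 / \<epsilon>\<^sup>2
        \<le> real (f_row S) * (p_norm 1 t)\<^sup>2 * (c\<^sub>2 * D * ln ?y / \<gamma>)\<^sup>2 / \<epsilon>\<^sup>2"
      by (intro divide_right_mono mult_left_mono) auto
    also have "\<dots> = (c\<^sub>2 * D)\<^sup>2 * ?G"
      by (simp add: power_mult_distrib power_divide)
    also have "\<dots> \<le> max 1 ((c\<^sub>2 * D)\<^sup>2) * max 1 ?G"
      by (intro mult_mono) auto
    finally have "max 1 (real (f_row S) * (p_norm 1 t)\<^sup>2 * (real L)\<^sup>2 / \<epsilon>\<^sup>2)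
        \<le> max 1 ((c\<^sub>2 * D)\<^sup>2) * max 1 ?G"
      using mult_mono[of 1 "max 1 ((c\<^sub>2 * D)\<^sup>2)" 1 "max 1 ?G"] by simp
    then have "C * max 1 (real (f_row S) * (p_norm 1 t)\<^sup>2 * (real L)\<^sup>2 / \<epsilon>\<^sup>2) \<le> C' * max 1 ?G"
      unfolding C'_def mult.assoc[of C] by (intro mult_left_mono) (auto simp: C_def)
    with p(3) have "real (clock s) \<le> C' * max 1 ?G" if "s \<in> set_pmf p" for s
      using that by (meson order_trans)
    with p show "lossless_spmf out \<and>
      measure (measure_spmf out) {s. \<bar>result s - t \<bullet> x\<bar> \<le> \<epsilon> * p_norm \<infinity> x} \<ge> 3 / 4 \<and>
      (\<forall>s\<in>set_spmf out.
         real (clock s) \<le> C * max 1 (real (f_row S) * (p_norm 1 t)\<^sup>2 * (real L)\<^sup>2 / \<epsilon>\<^sup>2) \<and>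
         real (clock s) \<le> C' * max 1 ?G)"
      unfolding out x by simp
  qed
qed

end
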